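(* Let $R$ be a ring that is not right perfect. Then a free right $R$-module is regularly weakly based if and only if it is finitely generated.
   Context: For a subset $X$ of a module $M$, $\operatorname{Span}(X)$ denotes the submodule generated by $X$. A subset $X$ of a module $M$ is weakly independent if $x \notin \operatorname{Span}(X \setminus \{x\})$ for all $x \in X$. A weak basis of $M$ is a weakly independent subset that generates $M$ (equivalently, a generating set minimal with respect to inclusion). A module $M$ is regularly weakly based if every generating set of $M$ contains a weak basis of $M$. *)

theory Defs
  imports "HOL-Algebra.Module" "HOL-Algebra.AbelCoset" HOL.Hull
begin

section \<open>Right modules\<close>

text \<open>
  The library locale \<open>module\<close> requires a commutative ring, so right modules over an arbitrary
  unital associative ring are introduced here, on the library record of modules.
  The field \<open>smult\<close> of that record takes the scalar first; in a right module, \<open>r \<odot> x\<close> denotes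
  the element usually written \<open>x r\<close>.  This is why the order is reversed in \<open>smult_assoc\<close>,
  which says \<open>x (a b) = (x a) b\<close>.  The ring multiplication and unit that the record also
  carries on \<open>M\<close> play no role.
\<close>

locale right_module = R?: ring R + M?: abelian_group M
  for R :: "('a, 'r) ring_scheme" (structure) and M :: "('a, 'm) module" (structure) +
  assumes smult_closed:
      "\<lbrakk>a \<in> carrier R; x \<in> carrier M\<rbrakk> \<Longrightarrow> a \<odot>\<^bsub>M\<^esub> x \<in> carrier M"
    and smult_scalar_distr:
      "\<lbrakk>a \<in> carrier R; b \<in> carrier R; x \<in> carrier M\<rbrakk> \<Longrightarrow>
       (a \<oplus>\<^bsub>R\<^esub> b) \<odot>\<^bsub>M\<^esub> x = (a \<odot>\<^bsub>M\<^esub> x) \<oplus>\<^bsub>M\<^esub> (b \<odot>\<^bsub>M\<^esub> x)"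
    and smult_vector_distr:
      "\<lbrakk>a \<in> carrier R; x \<in> carrier M; y \<in> carrier M\<rbrakk> \<Longrightarrow>
       a \<odot>\<^bsub>M\<^esub> (x \<oplus>\<^bsub>M\<^esub> y) = (a \<odot>\<^bsub>M\<^esub> x) \<oplus>\<^bsub>M\<^esub> (a \<odot>\<^bsub>M\<^esub> y)"
    and smult_assoc:
      "\<lbrakk>a \<in> carrier R; b \<in> carrier R; x \<in> carrier M\<rbrakk> \<Longrightarrow>
       (a \<otimes>\<^bsub>R\<^esub> b) \<odot>\<^bsub>M\<^esub> x = b \<odot>\<^bsub>M\<^esub> (a \<odot>\<^bsub>M\<^esub> x)"
    and smult_one:
      "x \<in> carrier M \<Longrightarrow> \<one>\<^bsub>R\<^esub> \<odot>\<^bsub>M\<^esub> x = x"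

definition mod_span :: "('a, 'r) ring_scheme \<Rightarrow> ('a, 'm) module \<Rightarrow> 'm set \<Rightarrow> 'm set" where
  "mod_span R M S = (\<lambda>N. submodule N R M) hull S"

definition generating_set :: "('a, 'r) ring_scheme \<Rightarrow> ('a, 'm) module \<Rightarrow> 'm set \<Rightarrow> bool" where
  "generating_set R M S \<longleftrightarrow> S \<subseteq> carrier M \<and> mod_span R M S = carrier M"

definition finitely_generated :: "('a, 'r) ring_scheme \<Rightarrow> ('a, 'm) module \<Rightarrow> bool" where
  "finitely_generated R M \<longleftrightarrow> (\<exists>S. finite S \<and> generating_set R M S)"

definition linearly_independent :: "('a, 'r) ring_scheme \<Rightarrow> ('a, 'm) module \<Rightarrow> 'm set \<Rightarrow> bool" where
  "linearly_independent R M S \<longleftrightarrow> S \<subseteq> carrier M \<and>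
     (\<forall>A c. finite A \<and> A \<subseteq> S \<and> c \<in> A \<rightarrow> carrier R \<and>
        (\<Oplus>\<^bsub>M\<^esub>x\<in>A. c x \<odot>\<^bsub>M\<^esub> x) = \<zero>\<^bsub>M\<^esub> \<longrightarrow> (\<forall>x\<in>A. c x = \<zero>\<^bsub>R\<^esub>))"

definition free_module :: "('a, 'r) ring_scheme \<Rightarrow> ('a, 'm) module \<Rightarrow> bool" where
  "free_module R M \<longleftrightarrow> (\<exists>S. linearly_independent R M S \<and> generating_set R M S)"


section \<open>Weak bases\<close>

definition weakly_independent :: "('a, 'r) ring_scheme \<Rightarrow> ('a, 'm) module \<Rightarrow> 'm set \<Rightarrow> bool" where
  "weakly_independent R M S \<longleftrightarrow> S \<subseteq> carrier M \<and> (\<forall>x\<in>S. x \<notin> mod_span R M (S - {x}))"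

definition weak_basis :: "('a, 'r) ring_scheme \<Rightarrow> ('a, 'm) module \<Rightarrow> 'm set \<Rightarrow> bool" where
  "weak_basis R M S \<longleftrightarrow> weakly_independent R M S \<and> generating_set R M S"

definition regularly_weakly_based :: "('a, 'r) ring_scheme \<Rightarrow> ('a, 'm) module \<Rightarrow> bool" where
  "regularly_weakly_based R M \<longleftrightarrow>
     (\<forall>S. generating_set R M S \<longrightarrow> (\<exists>Y\<subseteq>S. weak_basis R M Y))"


section \<open>Projective covers and right perfect rings\<close>

definition right_module_hom ::
    "('a, 'r) ring_scheme \<Rightarrow> ('a, 'm) module \<Rightarrow> ('a, 'n) module \<Rightarrow> ('m \<Rightarrow> 'n) set" where
  "right_module_hom R M N = {h \<in> hom (add_monoid M) (add_monoid N).
     \<forall>a\<in>carrier R. \<forall>x\<in>carrier M. h (a \<odot>\<^bsub>M\<^esub> x) = a \<odot>\<^bsub>N\<^esub> h x}"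

definition right_module_epi ::
    "('a, 'r) ring_scheme \<Rightarrow> ('a, 'm) module \<Rightarrow> ('a, 'n) module \<Rightarrow> ('m \<Rightarrow> 'n) set" where
  "right_module_epi R M N = {h \<in> right_module_hom R M N. h ` carrier M = carrier N}"

text \<open>
  Projectivity is the lifting property against epimorphisms \<open>g : A \<rightarrow> B\<close>.  HOL cannot quantify
  over the types of \<open>A\<close> and \<open>B\<close> inside a definition, so these are chosen large enough.
  They contain the epimorphism from the free module with basis the carrier of \<open>P\<close> (finitely
  supported functions \<open>'p \<Rightarrow> 'a\<close>) onto \<open>P\<close> itself.  Lifting the identity of \<open>P\<close> along it makes
  \<open>P\<close> a direct summand of a free module, and hence yields the lifting property for modules
  \<open>A\<close> and \<open>B\<close> over any types.
\<close>

definition projective_module :: "('a, 'r) ring_scheme \<Rightarrow> ('a, 'p) module \<Rightarrow> bool" where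
  "projective_module R P \<longleftrightarrow> right_module R P \<and>
     (\<forall>(A :: ('a, 'p \<Rightarrow> 'a) module) (B :: ('a, 'p) module) g f.
        right_module R A \<and> right_module R B \<and>
        g \<in> right_module_epi R A B \<and> f \<in> right_module_hom R P B \<longrightarrow>
        (\<exists>h \<in> right_module_hom R P A. \<forall>x\<in>carrier P. g (h x) = f x))"

definition superfluous :: "('a, 'r) ring_scheme \<Rightarrow> ('a, 'm) module \<Rightarrow> 'm set \<Rightarrow> bool" where
  "superfluous R M K \<longleftrightarrow> submodule K R M \<and>
     (\<forall>N. submodule N R M \<and> K <+>\<^bsub>M\<^esub> N = carrier M \<longrightarrow> N = carrier M)"

definition projective_cover ::
    "('a, 'r) ring_scheme \<Rightarrow> ('a, 'p) module \<Rightarrow> ('a, 'm) module \<Rightarrow> ('p \<Rightarrow> 'm) \<Rightarrow> bool" where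
  "projective_cover R P M p \<longleftrightarrow> projective_module R P \<and>
     p \<in> right_module_epi R P M \<and> superfluous R P (a_kernel P M p)"

text \<open>
  A ring is right perfect if every right module has a projective cover.  In HOL the type \<open>'m\<close>
  of the modules concerned has to be a parameter.  A ring is not right perfect
  iff \<open>\<not> right_perfect TYPE('m) R\<close> for some type \<open>'m\<close>, so a theorem with
  this hypothesis and a free type variable \<open>'m\<close> is a theorem about all rings that are
  not right perfect.

  Looking for the cover of \<open>M\<close> among the modules over the type \<open>'m \<Rightarrow> 'a\<close> is no restriction.
  Let \<open>p : P \<rightarrow> M\<close> be a projective cover over any type, and choose a preimage of each element of
  \<open>M\<close>.  The submodule \<open>N\<close> generated by these preimages satisfies \<open>ker p + N = P\<close>, so \<open>N = P\<close> as
  \<open>ker p\<close> is superfluous.  So \<open>P\<close> is an epimorphic image of the free module with basis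
  the carrier of \<open>M\<close>; the epimorphism splits, and \<open>P\<close> is isomorphic to a submodule of that free
  module, whose elements are finitely supported functions \<open>'m \<Rightarrow> 'a\<close>.
\<close>

definition right_perfect :: "'m itself \<Rightarrow> ('a, 'r) ring_scheme \<Rightarrow> bool" where
  "right_perfect (_ :: 'm itself) R \<longleftrightarrow> ring R \<and>
     (\<forall>M :: ('a, 'm) module. right_module R M \<longrightarrow>
        (\<exists>(P :: ('a, 'm \<Rightarrow> 'a) module) p. projective_cover R P M p))"

end

theory Submission
  imports Defs "HOL-Algebra.Multiplicative_Group"
begin

text \<open>
  That a finitely generated module is regularly weakly based holds over any ring: a generating set contains a
  finite one, which can be thinned out to a minimal one.  For the converse let the free module \<open>F\<close> have
  an infinite basis and be regularly weakly based; then \<open>R\<close> is right perfect, as follows.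

  A sequence \<open>a\<close> of ring elements defines Bass's module \<open>B(a)\<close> with generators \<open>e n\<close> and relations
  \<open>e n = e (n+1) a n\<close>.  If no \<open>a n\<close> is right invertible, a presentation of \<open>B(a)\<close> inside \<open>F\<close> gives a
  generating set of \<open>F\<close> consisting of the relators, certain lifts of the \<open>e n\<close>, and the rest of the basis;
  the lifts are chosen in such a way that no relator can be omitted.  A weak basis within this set
  then leads to a generating subset of \<open>B(a)\<close> that cannot contain infinitely many \<open>e n\<close>, as they generate
  an increasing chain of cyclic submodules.  Hence this chain is not strictly increasing
  (\<open>regularly_weakly_based_imp_no_strict_bass_chain\<close>).

  Three kinds of sequences make this property useful.  A sequence in the Jacobson radical \<open>J\<close> has a vanishing
  product, so \<open>J\<close> is T-nilpotent.  Constant sequences show that \<open>R\<close> is strongly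
  \<open>\<pi>\<close>-regular, and by Dischinger's theorem every right ideal not contained in \<open>J\<close> contains a
  nonzero idempotent.  The sequences \<open>1 - f n\<close> with orthogonal idempotents \<open>f n\<close> show that there are no infinite
  families of nonzero orthogonal idempotents.  Together, \<open>1\<close> is a sum of idempotents \<open>f\<close> for which
  \<open>f R\<close> is a local module (\<open>one_sum_of_local_idempotents\<close>).

  Now any right module \<open>M\<close> has a projective cover: take a family of elements \<open>x = x f\<close>, with \<open>f\<close>
  local, that generates \<open>M\<close> irredundantly modulo \<open>M J\<close>, and map the direct sum of the corresponding \<open>f R\<close>
  to \<open>M\<close>.  By T-nilpotence of \<open>J\<close> Nakayama's lemma holds for all modules (\<open>radical_Nakayama\<close>); it makes
  this map onto and its kernel superfluous (\<open>no_strict_bass_chain_imp_right_perfect\<close>).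
\<close>


section \<open>Rings without strict Bass chains\<close>

definition right_invertible :: "('a, 'r) ring_scheme \<Rightarrow> 'a \<Rightarrow> bool" where
  "right_invertible R a \<longleftrightarrow> (\<exists>s\<in>carrier R. a \<otimes>\<^bsub>R\<^esub> s = \<one>\<^bsub>R\<^esub>)"

definition jacobson_radical :: "('a, 'r) ring_scheme \<Rightarrow> 'a set" where
  "jacobson_radical R =
     {a \<in> carrier R. \<forall>r\<in>carrier R. right_invertible R (\<one>\<^bsub>R\<^esub> \<ominus>\<^bsub>R\<^esub> a \<otimes>\<^bsub>R\<^esub> r)}"

text \<open>
  \<open>leftward_prod R a n k\<close> is \<open>a (n + k - 1) \<otimes> \<dots> \<otimes> a n\<close>: later factors stand further left, as in a
  composition of left multiplications.
\<close>

primrec leftward_prod :: "('a, 'r) ring_scheme \<Rightarrow> (nat \<Rightarrow> 'a) \<Rightarrow> nat \<Rightarrow> nat \<Rightarrow> 'a" where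
  "leftward_prod R a n 0 = \<one>\<^bsub>R\<^esub>"
| "leftward_prod R a n (Suc k) = a (n + k) \<otimes>\<^bsub>R\<^esub> leftward_prod R a n k"

definition T_nilpotent :: "('a, 'r) ring_scheme \<Rightarrow> 'a set \<Rightarrow> bool" where
  "T_nilpotent R J \<longleftrightarrow> (\<forall>a. (\<forall>n. a n \<in> J) \<longrightarrow> (\<exists>n. leftward_prod R a 0 n = \<zero>\<^bsub>R\<^esub>))"

text \<open>
  A sequence \<open>a\<close> defines a right module \<open>B(a)\<close> with generators \<open>e n\<close> and relations
  \<open>e n = e (n+1) a n\<close>: the direct limit of \<open>R \<rightarrow> R \<rightarrow> \<dots>\<close> along left multiplications by the \<open>a n\<close>,
  introduced by Bass.  An element \<open>e (N+1) c\<close> vanishes in \<open>B(a)\<close> iff some product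
  \<open>a (N+k) \<otimes> \<dots> \<otimes> a (N+1) \<otimes> c\<close> is zero.  So the equation below says that \<open>e (N+1)\<close> lies in the
  cyclic submodule generated by \<open>e N\<close>, and the definition says that, for sequences without right
  invertible terms, the chain of cyclic submodules generated by \<open>e 0, e 1, \<dots>\<close> is never strictly
  increasing.  Stating this in the ring avoids
  constructing \<open>B(a)\<close>.
\<close>

definition no_strict_bass_chain :: "('a, 'r) ring_scheme \<Rightarrow> bool" where
  "no_strict_bass_chain R \<longleftrightarrow>
     (\<forall>a. (\<forall>n. a n \<in> carrier R \<and> \<not> right_invertible R (a n)) \<longrightarrow>
        (\<exists>N k. \<exists>r\<in>carrier R.
           leftward_prod R a (Suc N) k \<otimes>\<^bsub>R\<^esub> (\<one>\<^bsub>R\<^esub> \<ominus>\<^bsub>R\<^esub> a N \<otimes>\<^bsub>R\<^esub> r) = \<zero>\<^bsub>R\<^esub>))"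

text \<open>
  For \<open>f \<noteq> 0\<close> this says that the right ideal \<open>f R\<close> has \<open>f R \<inter> J\<close> as its only maximal submodule: every
  element outside \<open>J\<close> generates \<open>f R\<close>.
\<close>

definition local_idempotent :: "('a, 'r) ring_scheme \<Rightarrow> 'a \<Rightarrow> bool" where
  "local_idempotent R f \<longleftrightarrow> f \<in> carrier R \<and> f \<otimes>\<^bsub>R\<^esub> f = f \<and>
     (\<forall>r\<in>carrier R - jacobson_radical R. f \<otimes>\<^bsub>R\<^esub> r = r \<longrightarrow> (\<exists>s\<in>carrier R. r \<otimes>\<^bsub>R\<^esub> s = f))"

inductive sum_of_local_idempotents :: "('a, 'r) ring_scheme \<Rightarrow> 'a \<Rightarrow> bool"
  for R :: "('a, 'r) ring_scheme" where
  zero: "sum_of_local_idempotents R \<zero>\<^bsub>R\<^esub>"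
| single: "local_idempotent R f \<Longrightarrow> sum_of_local_idempotents R f"
| add: "sum_of_local_idempotents R g \<Longrightarrow> sum_of_local_idempotents R h \<Longrightarrow>
    sum_of_local_idempotents R (g \<oplus>\<^bsub>R\<^esub> h)"

context ring
begin

lemma jacobson_radical_closed: "a \<in> jacobson_radical R \<Longrightarrow> a \<in> carrier R"
  by (simp add: jacobson_radical_def)

lemma zero_in_jacobson_radical: "\<zero> \<in> jacobson_radical R"
  by (auto simp: jacobson_radical_def right_invertible_def a_minus_def)

lemma jacobson_radical_right_ideal:
  assumes "a \<in> jacobson_radical R" "r \<in> carrier R"
  shows "a \<otimes> r \<in> jacobson_radical R"
  using assms by (auto simp: jacobson_radical_def m_assoc)

lemma leftward_prod_closed:
  "(\<And>n. a n \<in> carrier R) \<Longrightarrow> leftward_prod R a n k \<in> carrier R"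
  by (induction k) auto

lemma leftward_prod_add:
  assumes "\<And>n. a n \<in> carrier R"
  shows "leftward_prod R a n (k + l) = leftward_prod R a (n + k) l \<otimes> leftward_prod R a n k"
  using assms by (induction l) (auto simp: leftward_prod_closed m_assoc add.assoc)

text \<open>
  Elements of the radical are not right invertible, so the chain condition applies; as
  \<open>1 - a N r\<close> is right invertible, it can be cancelled from the resulting equation.
\<close>

lemma jacobson_radical_T_nilpotent:
  assumes bass: "no_strict_bass_chain R"
  shows "T_nilpotent R (jacobson_radical R)"
  unfolding T_nilpotent_def
proof (intro allI impI)
  fix a :: "nat \<Rightarrow> 'a" assume a0: "\<forall>n. a n \<in> jacobson_radical R"
  show "\<exists>n. leftward_prod R a 0 n = \<zero>"
  proof (cases "\<one> = \<zero>")
    case True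
    then show ?thesis by (intro exI[of _ 0]) simp
  next
    case False
    have a: "a n \<in> jacobson_radical R" for n using a0 by blast
    have aR [simp]: "a n \<in> carrier R" for n
      using a jacobson_radical_closed by blast
    have "\<not> right_invertible R (a n)" for n
    proof
      assume "right_invertible R (a n)"
      then obtain s where s: "s \<in> carrier R" "a n \<otimes> s = \<one>"
        by (auto simp: right_invertible_def)
      then have "right_invertible R (\<one> \<ominus> \<one>)"
        using a[of n] by (force simp: jacobson_radical_def)
      then show False
        using False by (auto simp: right_invertible_def r_neg a_minus_def)
    qed
    then obtain N k r where r: "r \<in> carrier R"
      and 0: "leftward_prod R a (Suc N) k \<otimes> (\<one> \<ominus> a N \<otimes> r) = \<zero>"
      using bass unfolding no_strict_bass_chain_def by (metis aR)
    obtain s where s: "s \<in> carrier R" "(\<one> \<ominus> a N \<otimes> r) \<otimes> s = \<one>"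
      using a[of N] r by (auto simp: jacobson_radical_def right_invertible_def)
    have c: "leftward_prod R a (Suc N) k \<in> carrier R"
      by (simp add: leftward_prod_closed)
    have "leftward_prod R a (Suc N) k
        = leftward_prod R a (Suc N) k \<otimes> ((\<one> \<ominus> a N \<otimes> r) \<otimes> s)"
      using s c by simp
    also have "\<dots> = leftward_prod R a (Suc N) k \<otimes> (\<one> \<ominus> a N \<otimes> r) \<otimes> s"
      using s c r by (simp add: m_assoc)
    finally have "leftward_prod R a (Suc N) k = \<zero>"
      using 0 s by simp
    then have "leftward_prod R a 0 (Suc N + k) = \<zero>"
      using leftward_prod_add[of a 0 "Suc N" k] leftward_prod_closed[of a 0 "Suc N"] by simp
    then show ?thesis by blast
  qed
qed

text \<open>
  The chain condition is applied to the constant sequence \<open>a\<close>.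
\<close>

lemma strongly_pi_regular:
  assumes bass: "no_strict_bass_chain R" and a: "a \<in> carrier R"
  shows "\<exists>n. \<exists>r\<in>carrier R. a [^] n = a [^] Suc n \<otimes> r"
proof (cases "right_invertible R a")
  case True
  then obtain s where "s \<in> carrier R" "a \<otimes> s = \<one>"
    by (auto simp: right_invertible_def)
  then show ?thesis
    using a by (intro exI[of _ 0] bexI[of _ s]) simp_all
next
  case False
  have pow: "leftward_prod R (\<lambda>_. a) n k = a [^] k" for n k
    by (induction k) (simp_all flip: nat_pow_Suc2[OF a])
  obtain k r where r: "r \<in> carrier R" and 0: "a [^] (k::nat) \<otimes> (\<one> \<ominus> a \<otimes> r) = \<zero>"
    using bass[unfolded no_strict_bass_chain_def, rule_format, of "\<lambda>_. a"] a False
    unfolding pow by blast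
  have "a [^] k \<otimes> (\<one> \<ominus> a \<otimes> r) = a [^] k \<ominus> a [^] Suc k \<otimes> r"
    using a r by (simp add: a_minus_def r_distr r_minus) (simp add: m_assoc)
  then have "a [^] k = a [^] Suc k \<otimes> r"
    using 0 a r by (metis r_right_minus_eq m_closed nat_pow_closed)
  then show ?thesis
    using r by blast
qed

lemma strongly_pi_regular_power:
  assumes "a \<in> carrier R" "r \<in> carrier R" "a [^] n = a [^] Suc n \<otimes> r"
  shows "a [^] n = a [^] (n + j) \<otimes> r [^] (j::nat)"
proof (induction j)
  case 0
  then show ?case using assms by simp
next
  case (Suc j)
  have "a [^] (n + Suc j) \<otimes> r [^] Suc j = (a [^] j \<otimes> a [^] Suc n) \<otimes> (r \<otimes> r [^] j)"
    unfolding nat_pow_mult[OF assms(1)] nat_pow_Suc2[OF assms(2)] by (simp add: add.commute)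
  also have "\<dots> = a [^] j \<otimes> (a [^] Suc n \<otimes> r) \<otimes> r [^] j"
    using assms(1,2) by (simp add: m_assoc)
  also have "\<dots> = a [^] (n + j) \<otimes> r [^] j"
    using assms by (metis nat_pow_mult add.commute)
  finally show ?case using Suc by simp
qed

text \<open>
  Dischinger's theorem, in the form in which it yields idempotents: if every element of the ring is
  right strongly \<open>\<pi>\<close>-regular and \<open>a = a a x\<close>, then also \<open>a = a x a\<close>.  With \<open>x\<^sup>n = x\<^sup>n\<^sup>+\<^sup>1 y\<close> one gets
  \<open>a y = a a\<close>, so \<open>d = y - a\<close> is annihilated by \<open>a\<close> from the left.  Moreover \<open>a x\<^sup>j d\<^sup>j\<^sup>+\<^sup>1 = 0\<close> while
  \<open>a x\<^sup>j\<^sup>+\<^sup>1 d\<^sup>j\<^sup>+\<^sup>1\<close> is the defect \<open>a - a x a\<close> for every \<open>j\<close>.  Strong \<open>\<pi>\<close>-regularity of \<open>d\<close> makes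
  the defect a right multiple of a product of the first kind.
\<close>

lemma dischinger:
  assumes spr: "\<And>c. c \<in> carrier R \<Longrightarrow> \<exists>n. \<exists>r\<in>carrier R. c [^] (n::nat) = c [^] Suc n \<otimes> r"
    and a: "a \<in> carrier R" and x: "x \<in> carrier R" and aax: "a = a \<otimes> a \<otimes> x"
  shows "a = a \<otimes> x \<otimes> a"
proof -
  obtain n :: nat and y where y: "y \<in> carrier R" and xy: "x [^] n = x [^] Suc n \<otimes> y"
    using spr[OF x] by blast
  define d where "d = y \<ominus> a"
  have d: "d \<in> carrier R" using a y by (simp add: d_def)
  have F1: "a = a [^] Suc j \<otimes> x [^] j" for j :: nat
    using strongly_pi_regular_power[OF a x, of 1 j] aax a by simp
  have F2: "a \<otimes> x [^] Suc j \<otimes> y = a \<otimes> x [^] j" for j :: nat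
  proof -
    have "a \<otimes> x [^] Suc j \<otimes> y = a [^] Suc n \<otimes> x [^] n \<otimes> x [^] Suc j \<otimes> y"
      using F1[of n] by simp
    also have "\<dots> = a [^] Suc n \<otimes> (x [^] n \<otimes> x [^] Suc j) \<otimes> y"
      using a x by (simp add: m_assoc del: nat_pow_Suc)
    also have "x [^] n \<otimes> x [^] Suc j = x [^] j \<otimes> x [^] Suc n"
      unfolding nat_pow_mult[OF x] by (simp add: add.commute)
    also have "a [^] Suc n \<otimes> (x [^] j \<otimes> x [^] Suc n) \<otimes> y = a [^] Suc n \<otimes> (x [^] j \<otimes> (x [^] Suc n \<otimes> y))"
      using a x y by (simp add: m_assoc del: nat_pow_Suc)
    also have "\<dots> = a [^] Suc n \<otimes> (x [^] n \<otimes> x [^] j)"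
      unfolding xy[symmetric] nat_pow_mult[OF x] by (simp add: add.commute)
    also have "\<dots> = a [^] Suc n \<otimes> x [^] n \<otimes> x [^] j"
      using a x by (simp add: m_assoc del: nat_pow_Suc)
    finally show ?thesis using F1[of n] by simp
  qed
  have "a \<otimes> y = a \<otimes> (a \<otimes> x [^] Suc 0 \<otimes> y)"
    using aax a x y by (metis m_assoc m_closed nat_pow_Suc nat_pow_0 l_one)
  then have ad: "a \<otimes> d = \<zero>"
    unfolding F2 using a y by (simp add: d_def a_minus_def r_distr r_minus r_neg)
  have F4: "a \<otimes> x [^] Suc j \<otimes> d = a \<otimes> x [^] j \<ominus> a \<otimes> x [^] Suc j \<otimes> a" for j :: nat
    using a x y F2[of j] by (simp add: d_def a_minus_def r_distr r_minus del: nat_pow_Suc)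
  have step: "a \<otimes> x [^] Suc j \<otimes> d [^] Suc (Suc i) = a \<otimes> x [^] j \<otimes> d [^] Suc i" for i j :: nat
  proof -
    have "a \<otimes> x [^] Suc j \<otimes> d [^] Suc (Suc i) = a \<otimes> x [^] Suc j \<otimes> (d \<otimes> d [^] Suc i)"
      using nat_pow_Suc2[OF d, of "Suc i"] by simp
    also have "\<dots> = (a \<otimes> x [^] Suc j \<otimes> d) \<otimes> d [^] Suc i"
      using a x d by (simp add: m_assoc del: nat_pow_Suc)
    also have "\<dots> = a \<otimes> x [^] j \<otimes> d [^] Suc i \<ominus> a \<otimes> x [^] Suc j \<otimes> a \<otimes> d [^] Suc i"
      unfolding F4 using a x d by (simp add: a_minus_def l_distr l_minus del: nat_pow_Suc)
    also have "a \<otimes> x [^] Suc j \<otimes> a \<otimes> d [^] Suc i = a \<otimes> x [^] Suc j \<otimes> ((a \<otimes> d) \<otimes> d [^] i)"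
      unfolding nat_pow_Suc2[OF d] using a x d by (simp add: m_assoc del: nat_pow_Suc)
    finally show ?thesis
      using a x d ad by (simp add: a_minus_def)
  qed
  have F5: "a \<otimes> x [^] j \<otimes> d [^] Suc j = \<zero>" for j :: nat
  proof (induction j)
    case 0
    then show ?case using a d ad by simp
  next
    case (Suc j)
    then show ?case by (simp only: step)
  qed
  have F6: "a \<otimes> x [^] Suc j \<otimes> d [^] Suc j = a \<ominus> a \<otimes> x \<otimes> a" for j :: nat
  proof (induction j)
    case 0
    then show ?case using F4[of 0] a x d by simp
  next
    case (Suc j)
    then show ?case by (simp only: step)
  qed
  obtain m :: nat and w where w: "w \<in> carrier R" and dw: "d [^] m = d [^] Suc m \<otimes> w"
    using spr[OF d] by blast
  have "d [^] Suc m = d [^] Suc (Suc m) \<otimes> w"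
    using dw d w by (metis m_assoc nat_pow_closed nat_pow_Suc2)
  then have "a \<otimes> x [^] Suc m \<otimes> d [^] Suc m = (a \<otimes> x [^] Suc m \<otimes> d [^] Suc (Suc m)) \<otimes> w"
    using a x d w by (metis m_assoc m_closed nat_pow_closed)
  then have "a \<ominus> a \<otimes> x \<otimes> a = \<zero>"
    unfolding F6 F5 using w by simp
  then show ?thesis using a x by (metis m_closed r_right_minus_eq)
qed

text \<open>
  Some \<open>u = 1 - r t\<close> is not right invertible.  A power \<open>p = u\<^sup>n\<close> satisfies \<open>p = p p x\<close>, and by Dischinger's
  theorem \<open>p x\<close> is idempotent.  The complement \<open>z = 1 - p x\<close> is nonzero because \<open>u\<close> is not right
  invertible, and \<open>p z = 0\<close> puts \<open>z = (1 - p) z\<close> into \<open>r R\<close>, since \<open>1 - p\<close> is a right multiple of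
  \<open>1 - u\<close>.
\<close>

lemma exists_idempotent_outside_radical:
  assumes bass: "no_strict_bass_chain R" and r: "r \<in> carrier R - jacobson_radical R"
  shows "\<exists>t\<in>carrier R. r \<otimes> t \<noteq> \<zero> \<and> r \<otimes> t \<otimes> (r \<otimes> t) = r \<otimes> t"
proof -
  have rR: "r \<in> carrier R" using r by simp
  obtain t where t: "t \<in> carrier R" and nu: "\<not> right_invertible R (\<one> \<ominus> r \<otimes> t)"
    using r by (auto simp: jacobson_radical_def)
  define u where "u = \<one> \<ominus> r \<otimes> t"
  have u: "u \<in> carrier R" using rR t by (simp add: u_def)
  obtain n :: nat and q where q: "q \<in> carrier R" and uq: "u [^] n = u [^] Suc n \<otimes> q"
    using strongly_pi_regular[OF bass u] by blast
  define p where "p = u [^] n"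
  define x where "x = q [^] n"
  have p: "p \<in> carrier R" and x: "x \<in> carrier R" using u q by (simp_all add: p_def x_def)
  have ppx: "p = p \<otimes> p \<otimes> x"
    unfolding p_def x_def nat_pow_mult[OF u] by (rule strongly_pi_regular_power[OF u q uq])
  have pxp: "p = p \<otimes> x \<otimes> p"
    using dischinger[OF strongly_pi_regular[OF bass] p x ppx] .
  define z where "z = \<one> \<ominus> p \<otimes> x"
  have z: "z \<in> carrier R" using p x by (simp add: z_def)
  have pz: "p \<otimes> z = \<zero>"
    using ppx p x by (simp add: z_def a_minus_def r_distr r_minus r_neg flip: m_assoc)
  have "p \<otimes> x \<otimes> z = \<zero>"
  proof -
    have "p \<otimes> x \<otimes> (p \<otimes> x) = p \<otimes> x"
      using pxp p x by (simp flip: m_assoc)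
    then show ?thesis using p x by (simp add: z_def a_minus_def r_distr r_minus r_neg)
  qed
  then have zz: "z \<otimes> z = z"
    using p x z by (subst (1) z_def) (simp add: a_minus_def l_distr l_minus)
  have "z \<noteq> \<zero>"
  proof
    assume "z = \<zero>"
    then have "u [^] n \<otimes> x = \<one>"
      using p x r_right_minus_eq[of \<one> "p \<otimes> x"] by (simp add: z_def p_def)
    then have "u [^] Suc n \<otimes> (q \<otimes> x) = \<one>"
      using u q x by (subst (asm) uq) (simp add: m_assoc)
    then have "u \<otimes> (u [^] n \<otimes> (q \<otimes> x)) = \<one>"
      using u q x unfolding nat_pow_Suc2[OF u] by (simp add: m_assoc)
    moreover have "u [^] n \<otimes> (q \<otimes> x) \<in> carrier R" using u q x by simp
    ultimately show False using nu unfolding u_def right_invertible_def by blast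
  qed
  have "\<exists>v\<in>carrier R. \<one> \<ominus> u [^] k = r \<otimes> v" for k :: nat
  proof (induction k)
    case 0
    then show ?case using rR by (intro bexI[of _ \<zero>]) (auto simp: a_minus_def r_neg)
  next
    case (Suc k)
    then obtain v where v: "v \<in> carrier R" "\<one> \<ominus> u [^] k = r \<otimes> v" by blast
    have telescope: "\<one> \<ominus> w = (u \<ominus> w) \<oplus> (\<one> \<ominus> u)" if "w \<in> carrier R" for w
      using u that by algebra
    have "\<one> \<ominus> u [^] Suc k = (\<one> \<ominus> u [^] k) \<otimes> u \<oplus> (\<one> \<ominus> u)"
      unfolding telescope[OF nat_pow_closed[OF u], of "Suc k"] using u
      by (simp add: a_minus_def l_distr l_minus)
    also have "\<one> \<ominus> u = r \<otimes> t"
      using rR t by (simp add: u_def a_minus_def minus_add r_neg2)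
    finally have "\<one> \<ominus> u [^] Suc k = r \<otimes> (v \<otimes> u \<oplus> t)"
      using rR t v u by (simp add: r_distr m_assoc)
    then show ?case using v u t by blast
  qed
  then obtain v where v: "v \<in> carrier R" "\<one> \<ominus> p = r \<otimes> v" unfolding p_def by blast
  have "z = (\<one> \<ominus> p) \<otimes> z"
    using pz p z by (simp add: a_minus_def l_distr l_minus)
  then have "z = r \<otimes> (v \<otimes> z)"
    using v rR z by (simp add: m_assoc)
  then show ?thesis using zz \<open>z \<noteq> \<zero>\<close> v z by (metis m_closed)
qed

text \<open>
  A strictly decreasing sequence \<open>e\<close> would produce nonzero orthogonal idempotents
  \<open>f n = e n - e (n+1)\<close>.  The elements \<open>a n = 1 - f n\<close> satisfy \<open>f N a n = f N\<close> for \<open>n \<noteq> N\<close>, while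
  \<open>f N a N = 0\<close>.  So multiplying the equation of the chain condition by \<open>f N\<close> from the left gives
  \<open>f N = 0\<close>.
\<close>

lemma no_infinite_descent_of_idempotents:
  assumes bass: "no_strict_bass_chain R"
    and e: "\<And>n. e n \<in> carrier R" "\<And>n. e n \<otimes> e n = e n"
    and desc: "\<And>n. e n \<otimes> e (Suc n) = e (Suc n)" "\<And>n. e (Suc n) \<otimes> e n = e (Suc n)"
  shows "\<exists>n. e (Suc n) = e n"
proof (rule ccontr)
  assume no: "\<nexists>n. e (Suc n) = e n"
  have le: "e n \<otimes> e (n + k) = e (n + k) \<and> e (n + k) \<otimes> e n = e (n + k)" for n k
  proof (induction k)
    case 0
    then show ?case using e by simp
  next
    case (Suc k)
    then show ?case using e desc by (metis add_Suc_right m_assoc)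
  qed
  define f where "f n = e n \<ominus> e (Suc n)" for n
  have f: "f n \<in> carrier R" for n using e by (simp add: f_def)
  have ff: "f n \<otimes> f n = f n" for n
    using e desc by (simp add: f_def a_minus_def l_distr r_distr l_minus r_minus r_neg)
  have f0: "f n \<noteq> \<zero>" for n
    using no e r_right_minus_eq[of "e n" "e (Suc n)"] by (metis f_def)
  have ef: "e n \<otimes> f m = \<zero> \<and> f m \<otimes> e n = \<zero>" if mn: "m < n" for m n
  proof -
    obtain k where "n = Suc m + k" using less_imp_Suc_add[OF mn] by auto
    then have "e m \<otimes> e n = e n" "e n \<otimes> e m = e n"
        "e (Suc m) \<otimes> e n = e n" "e n \<otimes> e (Suc m) = e n"
      using le[of m "Suc k"] le[of "Suc m" k] by auto
    then show ?thesis
      using e by (simp add: f_def a_minus_def l_distr r_distr l_minus r_minus r_neg)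
  qed
  have orth: "f n \<otimes> f m = \<zero>" if "n \<noteq> m" for n m
  proof (cases "m < n")
    case True
    have "f n \<otimes> f m = e n \<otimes> f m \<ominus> e (Suc n) \<otimes> f m"
      using e f by (simp add: f_def[of n] a_minus_def l_distr l_minus)
    then show ?thesis using ef[of m n] ef[of m "Suc n"] True by (simp add: a_minus_def)
  next
    case False
    have "f n \<otimes> f m = f n \<otimes> e m \<ominus> f n \<otimes> e (Suc m)"
      using e f by (simp add: f_def[of m] a_minus_def r_distr r_minus)
    then show ?thesis using ef[of n m] ef[of n "Suc m"] False that by (simp add: a_minus_def)
  qed
  define a where "a n = \<one> \<ominus> f n" for n
  have a: "a n \<in> carrier R" for n using f by (simp add: a_def)
  have fa0: "f n \<otimes> a n = \<zero>" for n
    using f ff by (simp add: a_def a_minus_def r_distr r_minus r_neg)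
  have fa: "f n \<otimes> a m = f n" if "n \<noteq> m" for n m
    using f orth[OF that] by (simp add: a_def a_minus_def r_distr r_minus)
  have not_ri: "\<not> right_invertible R (a n)" for n
  proof
    assume "right_invertible R (a n)"
    then obtain s where "s \<in> carrier R" "a n \<otimes> s = \<one>" by (auto simp: right_invertible_def)
    then show False using fa0[of n] f[of n] f0[of n] a[of n] by (metis m_assoc l_null r_one)
  qed
  then obtain N k r where r: "r \<in> carrier R"
    and 0: "leftward_prod R a (Suc N) k \<otimes> (\<one> \<ominus> a N \<otimes> r) = \<zero>"
    using bass[unfolded no_strict_bass_chain_def, rule_format, of a] a not_ri by blast
  have fP: "f N \<otimes> leftward_prod R a (Suc N) j = f N" for j
  proof (induction j)
    case 0
    then show ?case using f by simp
  next
    case (Suc j)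
    have "f N \<otimes> leftward_prod R a (Suc N) (Suc j)
        = (f N \<otimes> a (Suc N + j)) \<otimes> leftward_prod R a (Suc N) j"
      using f a leftward_prod_closed[of a] by (simp add: m_assoc)
    then show ?case using Suc fa[of N "Suc N + j"] by simp
  qed
  have "f N \<otimes> (\<one> \<ominus> a N \<otimes> r) = f N \<otimes> leftward_prod R a (Suc N) k \<otimes> (\<one> \<ominus> a N \<otimes> r)"
    by (simp add: fP)
  also have "\<dots> = \<zero>"
    using f leftward_prod_closed[of a "Suc N" k] 0 r a by (simp add: m_assoc)
  finally have "f N \<ominus> (f N \<otimes> a N) \<otimes> r = \<zero>"
    using f a r by (simp add: a_minus_def r_distr r_minus m_assoc)
  then show False
    using fa0 f0 f r by (simp add: a_minus_def)
qed

text \<open>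
  If \<open>r \<in> f R\<close> lies outside the radical, \<open>r R\<close> contains a nonzero idempotent \<open>g\<close>, and \<open>g f\<close> is a nonzero
  idempotent below \<open>f\<close>, hence equal to \<open>f\<close>.
\<close>

lemma primitive_imp_local_idempotent:
  assumes bass: "no_strict_bass_chain R" and f: "f \<in> carrier R" "f \<otimes> f = f"
    and prim: "\<And>g. g \<in> carrier R \<Longrightarrow> g \<otimes> g = g \<Longrightarrow> f \<otimes> g = g \<Longrightarrow> g \<otimes> f = g \<Longrightarrow>
      g = \<zero> \<or> g = f"
  shows "local_idempotent R f"
  unfolding local_idempotent_def
proof (intro conjI ballI impI f)
  fix r assume r: "r \<in> carrier R - jacobson_radical R" "f \<otimes> r = r"
  obtain t where t: "t \<in> carrier R" "r \<otimes> t \<noteq> \<zero>" "r \<otimes> t \<otimes> (r \<otimes> t) = r \<otimes> t"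
    using exists_idempotent_outside_radical[OF bass r(1)] by blast
  define g where "g = r \<otimes> t"
  have g: "g \<in> carrier R" "g \<noteq> \<zero>" "g \<otimes> g = g" using r t by (auto simp: g_def)
  have fg: "f \<otimes> g = g"
    using r t f unfolding g_def by (metis DiffD1 m_assoc)
  have gfg: "g \<otimes> f \<otimes> g = g" using g fg f by (simp add: m_assoc)
  have "g \<otimes> f \<otimes> (g \<otimes> f) = g \<otimes> f" "f \<otimes> (g \<otimes> f) = g \<otimes> f" "g \<otimes> f \<otimes> f = g \<otimes> f"
    using g f fg gfg by (metis m_assoc m_closed)+
  then have "g \<otimes> f = \<zero> \<or> g \<otimes> f = f"
    using prim[of "g \<otimes> f"] g f by simp
  then have "g \<otimes> f = f" using gfg g by auto
  then have "r \<otimes> (t \<otimes> f) = f" using r t f by (simp add: g_def m_assoc)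
  then show "\<exists>s\<in>carrier R. r \<otimes> s = f" using t f by blast
qed

text \<open>
  An idempotent that is not a sum of local ones is not primitive, so it splits, and one of the two
  parts is again not such a sum.  Iterating gives an infinite descent.
\<close>

lemma one_sum_of_local_idempotents:
  assumes bass: "no_strict_bass_chain R"
  shows "sum_of_local_idempotents R \<one>"
proof (rule ccontr)
  assume bad: "\<not> sum_of_local_idempotents R \<one>"
  let ?B = "\<lambda>e. e \<in> carrier R \<and> e \<otimes> e = e \<and> \<not> sum_of_local_idempotents R e"
  let ?L = "\<lambda>e g. e \<otimes> g = g \<and> g \<otimes> e = g \<and> g \<noteq> e"
  have step: "\<exists>g. ?B g \<and> ?L e g" if e: "?B e" for e
  proof -
    have "\<not> local_idempotent R e"
      using e sum_of_local_idempotents.single[of R e] by blast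
    then obtain g where g: "g \<in> carrier R" "g \<otimes> g = g" "e \<otimes> g = g" "g \<otimes> e = g"
        "g \<noteq> \<zero>" "g \<noteq> e"
      using primitive_imp_local_idempotent[OF bass, of e] e by blast
    define h where "h = e \<ominus> g"
    have h: "h \<in> carrier R" "h \<otimes> h = h" "e \<otimes> h = h" "h \<otimes> e = h" "h \<noteq> e"
    proof -
      show "h \<in> carrier R" using e g by (simp add: h_def)
      show "e \<otimes> h = h" "h \<otimes> e = h"
        using e g by (simp_all add: h_def a_minus_def l_distr r_distr l_minus r_minus)
      moreover have "h \<otimes> g = \<zero>"
        using e g by (simp add: h_def a_minus_def l_distr l_minus r_neg)
      moreover have "h \<otimes> h = h \<otimes> e \<ominus> h \<otimes> g"
        using e g by (simp add: h_def a_minus_def r_distr r_minus)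
      ultimately show "h \<otimes> h = h" using \<open>h \<in> carrier R\<close> by (simp add: a_minus_def)
      show "h \<noteq> e"
      proof
        assume "h = e"
        then have "g = \<zero>" using \<open>h \<otimes> g = \<zero>\<close> g by simp
        then show False using g by simp
      qed
    qed
    have "e = g \<oplus> h"
      using e g unfolding h_def by algebra
    then have "\<not> sum_of_local_idempotents R g \<or> \<not> sum_of_local_idempotents R h"
      using e sum_of_local_idempotents.add by metis
    then show ?thesis using g h by blast
  qed
  have "?B \<one>" using bad by simp
  then obtain e where e: "\<And>n. ?B (e n) \<and> ?L (e n) (e (Suc n))"
    using dependent_nat_choice[of "\<lambda>_. ?B" "\<lambda>_. ?L"] step by blast
  then show False
    using no_infinite_descent_of_idempotents[OF bass, of e] by metis
qed

end


section \<open>Spans and Nakayama's lemma for right modules\<close>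

context right_module
begin

lemma smult_zero_left: "x \<in> carrier M \<Longrightarrow> \<zero>\<^bsub>R\<^esub> \<odot>\<^bsub>M\<^esub> x = \<zero>\<^bsub>M\<^esub>"
  using smult_scalar_distr[of "\<zero>\<^bsub>R\<^esub>" "\<zero>\<^bsub>R\<^esub>" x] smult_closed[of "\<zero>\<^bsub>R\<^esub>" x] by simp

lemma smult_zero_right: "a \<in> carrier R \<Longrightarrow> a \<odot>\<^bsub>M\<^esub> \<zero>\<^bsub>M\<^esub> = \<zero>\<^bsub>M\<^esub>"
  using smult_vector_distr[of a "\<zero>\<^bsub>M\<^esub>" "\<zero>\<^bsub>M\<^esub>"] smult_closed[of a "\<zero>\<^bsub>M\<^esub>"] by simp

lemma smult_minus_left:
  assumes "a \<in> carrier R" "x \<in> carrier M"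
  shows "(\<ominus>\<^bsub>R\<^esub> a) \<odot>\<^bsub>M\<^esub> x = \<ominus>\<^bsub>M\<^esub> (a \<odot>\<^bsub>M\<^esub> x)"
proof -
  have "(\<ominus>\<^bsub>R\<^esub> a) \<odot>\<^bsub>M\<^esub> x \<oplus>\<^bsub>M\<^esub> a \<odot>\<^bsub>M\<^esub> x = \<zero>\<^bsub>M\<^esub>"
    using assms smult_scalar_distr[of "\<ominus>\<^bsub>R\<^esub> a" a x]
    by (simp add: R.l_neg smult_zero_left)
  then show ?thesis
    using assms smult_closed by (intro M.minus_equality[symmetric]) auto
qed

lemma submodule_subset: "submodule N R M \<Longrightarrow> x \<in> N \<Longrightarrow> x \<in> carrier M"
  and submodule_zero: "submodule N R M \<Longrightarrow> \<zero>\<^bsub>M\<^esub> \<in> N"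
  and submodule_add: "submodule N R M \<Longrightarrow> x \<in> N \<Longrightarrow> y \<in> N \<Longrightarrow> x \<oplus>\<^bsub>M\<^esub> y \<in> N"
  and submodule_smult: "submodule N R M \<Longrightarrow> a \<in> carrier R \<Longrightarrow> x \<in> N \<Longrightarrow> a \<odot>\<^bsub>M\<^esub> x \<in> N"
  using subgroup.subset[of N "add_monoid M"] subgroup.one_closed[of N "add_monoid M"]
    subgroup.m_closed[of N "add_monoid M"] submodule.axioms(1)[of N R M]
    submodule.smult_closed[of N R M]
  by auto

lemma submodule_minus:
  assumes "submodule N R M" "x \<in> N"
  shows "\<ominus>\<^bsub>M\<^esub> x \<in> N"
  using submodule_smult[OF assms(1), of "\<ominus>\<^bsub>R\<^esub> \<one>\<^bsub>R\<^esub>" x] assms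
    smult_minus_left[of "\<one>\<^bsub>R\<^esub>" x] submodule_subset smult_one by auto

lemma right_submoduleI:
  assumes sub: "N \<subseteq> carrier M" and zero: "\<zero>\<^bsub>M\<^esub> \<in> N"
    and add: "\<And>x y. x \<in> N \<Longrightarrow> y \<in> N \<Longrightarrow> x \<oplus>\<^bsub>M\<^esub> y \<in> N"
    and smult: "\<And>a x. a \<in> carrier R \<Longrightarrow> x \<in> N \<Longrightarrow> a \<odot>\<^bsub>M\<^esub> x \<in> N"
  shows "submodule N R M"
proof -
  have "\<ominus>\<^bsub>M\<^esub> x \<in> N" if "x \<in> N" for x
    using smult[of "\<ominus>\<^bsub>R\<^esub> \<one>\<^bsub>R\<^esub>" x] that sub smult_minus_left[of "\<one>\<^bsub>R\<^esub>" x] smult_one by auto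
  then show ?thesis
    using assms by (intro submodule.intro subgroup.intro submodule_axioms.intro)
      (auto simp: a_inv_def)
qed

lemma carrier_submodule: "submodule (carrier M) R M"
  by (rule right_submoduleI) (auto simp: smult_closed)

lemma span_submodule:
  assumes "S \<subseteq> carrier M"
  shows "submodule (mod_span R M S) R M"
proof (rule right_submoduleI)
  show "mod_span R M S \<subseteq> carrier M"
    unfolding mod_span_def using assms carrier_submodule by (intro hull_minimal)
qed (auto simp: mod_span_def hull_def submodule_zero submodule_add submodule_smult)

lemma span_inc: "x \<in> S \<Longrightarrow> x \<in> mod_span R M S"
  unfolding mod_span_def by (rule hull_inc)

lemma span_minimal: "S \<subseteq> N \<Longrightarrow> submodule N R M \<Longrightarrow> mod_span R M S \<subseteq> N"
  unfolding mod_span_def by (rule hull_minimal)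

lemma span_mono: "S \<subseteq> T \<Longrightarrow> mod_span R M S \<subseteq> mod_span R M T"
  unfolding mod_span_def by (rule hull_mono)

lemma span_closed: "S \<subseteq> carrier M \<Longrightarrow> x \<in> mod_span R M S \<Longrightarrow> x \<in> carrier M"
  using span_submodule submodule_subset by blast

lemma span_subset_span:
  "T \<subseteq> carrier M \<Longrightarrow> S \<subseteq> mod_span R M T \<Longrightarrow> mod_span R M S \<subseteq> mod_span R M T"
  by (rule span_minimal[OF _ span_submodule])

lemma span_insert:
  assumes S: "S \<subseteq> carrier M" and y: "y \<in> carrier M"
    and x: "x \<in> mod_span R M (insert y S)"
  shows "\<exists>u\<in>mod_span R M S. \<exists>r\<in>carrier R. x = u \<oplus>\<^bsub>M\<^esub> r \<odot>\<^bsub>M\<^esub> y"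
proof -
  let ?N = "{u \<oplus>\<^bsub>M\<^esub> r \<odot>\<^bsub>M\<^esub> y | u r. u \<in> mod_span R M S \<and> r \<in> carrier R}"
  note sp = span_submodule[OF S]
  note cl = span_closed[OF S] smult_closed y
  have I: "u \<oplus>\<^bsub>M\<^esub> r \<odot>\<^bsub>M\<^esub> y \<in> ?N" if "u \<in> mod_span R M S" "r \<in> carrier R" for u r
    using that by blast
  have "submodule ?N R M"
  proof (rule right_submoduleI)
    show "?N \<subseteq> carrier M" using cl by auto
    show "\<zero>\<^bsub>M\<^esub> \<in> ?N"
      using I[OF submodule_zero[OF sp] R.zero_closed] y by (simp add: smult_zero_left)
  next
    fix v w assume "v \<in> ?N" "w \<in> ?N"
    then obtain u r u' r' where *: "u \<in> mod_span R M S" "r \<in> carrier R" "u' \<in> mod_span R M S"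
      "r' \<in> carrier R" and v: "v = u \<oplus>\<^bsub>M\<^esub> r \<odot>\<^bsub>M\<^esub> y" "w = u' \<oplus>\<^bsub>M\<^esub> r' \<odot>\<^bsub>M\<^esub> y" by blast
    have "v \<oplus>\<^bsub>M\<^esub> w = (u \<oplus>\<^bsub>M\<^esub> u') \<oplus>\<^bsub>M\<^esub> (r \<oplus>\<^bsub>R\<^esub> r') \<odot>\<^bsub>M\<^esub> y"
      using * cl by (simp add: v smult_scalar_distr M.a_ac)
    then show "v \<oplus>\<^bsub>M\<^esub> w \<in> ?N"
      using I[OF submodule_add[OF sp *(1,3)] R.add.m_closed[OF *(2,4)]] by simp
  next
    fix a v assume a: "a \<in> carrier R" and "v \<in> ?N"
    then obtain u r where *: "u \<in> mod_span R M S" "r \<in> carrier R"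
      and v: "v = u \<oplus>\<^bsub>M\<^esub> r \<odot>\<^bsub>M\<^esub> y" by blast
    have "a \<odot>\<^bsub>M\<^esub> v = a \<odot>\<^bsub>M\<^esub> u \<oplus>\<^bsub>M\<^esub> (r \<otimes>\<^bsub>R\<^esub> a) \<odot>\<^bsub>M\<^esub> y"
      using * a cl by (simp add: v smult_vector_distr smult_assoc)
    then show "a \<odot>\<^bsub>M\<^esub> v \<in> ?N"
      using I[OF submodule_smult[OF sp a *(1)] R.m_closed[OF *(2) a]] by simp
  qed
  moreover have "insert y S \<subseteq> ?N"
  proof (intro insert_subsetI subsetI)
    show "y \<in> ?N"
      using I[OF submodule_zero[OF sp] R.one_closed] y by (simp add: smult_one)
  next
    fix u assume "u \<in> S"
    then show "u \<in> ?N"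
      using I[OF span_inc[of u] R.zero_closed] S y
      by (auto simp: smult_zero_left subset_iff)
  qed
  ultimately show ?thesis using span_minimal x by blast
qed

lemma span_finite_character:
  assumes S: "S \<subseteq> carrier M" and x: "x \<in> mod_span R M S"
  shows "\<exists>A\<subseteq>S. finite A \<and> x \<in> mod_span R M A"
proof -
  let ?N = "{x. \<exists>A\<subseteq>S. finite A \<and> x \<in> mod_span R M A}"
  have sp: "submodule (mod_span R M A) R M" if "A \<subseteq> S" for A
    using span_submodule that S by blast
  have "submodule ?N R M"
  proof (rule right_submoduleI)
    show "?N \<subseteq> carrier M" using span_closed S by blast
    show "\<zero>\<^bsub>M\<^esub> \<in> ?N" using submodule_zero[OF sp[of "{}"]] by auto
  next
    fix x y assume "x \<in> ?N" "y \<in> ?N"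
    then obtain A B where *: "A \<subseteq> S" "finite A" "x \<in> mod_span R M A"
      "B \<subseteq> S" "finite B" "y \<in> mod_span R M B" by blast
    then have "x \<oplus>\<^bsub>M\<^esub> y \<in> mod_span R M (A \<union> B)"
      using submodule_add[OF sp[of "A \<union> B"]] span_mono[of A "A \<union> B"] span_mono[of B "A \<union> B"]
      by (meson Un_least Un_upper1 Un_upper2 subsetD)
    then show "x \<oplus>\<^bsub>M\<^esub> y \<in> ?N" using * by (intro CollectI exI[of _ "A \<union> B"]) auto
  next
    fix a x assume "a \<in> carrier R" "x \<in> ?N"
    then show "a \<odot>\<^bsub>M\<^esub> x \<in> ?N" using submodule_smult[OF sp] by blast
  qed
  moreover have "S \<subseteq> ?N"
  proof
    fix s assume "s \<in> S"
    then show "s \<in> ?N" using span_inc[of s "{s}"] by (intro CollectI exI[of _ "{s}"]) auto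
  qed
  ultimately show ?thesis using span_minimal x by blast
qed

lemma finitely_generated_imp_finite_generating_subset:
  assumes "finitely_generated R M" "generating_set R M X"
  shows "\<exists>A\<subseteq>X. finite A \<and> generating_set R M A"
proof -
  obtain S where S: "finite S" "S \<subseteq> carrier M" "mod_span R M S = carrier M"
    using assms by (auto simp: finitely_generated_def generating_set_def)
  have X: "X \<subseteq> carrier M" "mod_span R M X = carrier M"
    using assms by (auto simp: generating_set_def)
  then have "\<forall>s\<in>S. \<exists>A\<subseteq>X. finite A \<and> s \<in> mod_span R M A"
    using span_finite_character S by blast
  then obtain A where A: "\<And>s. s \<in> S \<Longrightarrow> A s \<subseteq> X \<and> finite (A s) \<and> s \<in> mod_span R M (A s)"
    by metis
  let ?A = "\<Union>(A ` S)"
  have AX: "?A \<subseteq> X" using A by blast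
  have "S \<subseteq> mod_span R M ?A" using A span_mono[of "A s" ?A for s] by blast
  then have "carrier M \<subseteq> mod_span R M ?A"
    using span_subset_span[of ?A S] AX X S by blast
  then have "generating_set R M ?A"
    using AX X span_closed[of ?A] by (auto simp: generating_set_def)
  then show ?thesis using AX A S by (intro exI[of _ ?A]) auto
qed

lemma generating_set_remove:
  assumes Y: "generating_set R M Y" and x: "x \<in> mod_span R M (Y - {x})"
  shows "generating_set R M (Y - {x})"
proof -
  have sub: "Y - {x} \<subseteq> carrier M" using Y by (auto simp: generating_set_def)
  have "Y \<subseteq> mod_span R M (Y - {x})" using x span_inc[of _ "Y - {x}"] by blast
  then have "carrier M \<subseteq> mod_span R M (Y - {x})"
    using span_subset_span[OF sub, of Y] Y by (simp add: generating_set_def)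
  then show ?thesis using sub span_closed[OF sub] by (auto simp: generating_set_def)
qed

text \<open>
  A generating set of a finitely generated module contains a finite one; one of least cardinality is
  a weak basis.
\<close>

lemma finitely_generated_imp_regularly_weakly_based:
  assumes "finitely_generated R M"
  shows "regularly_weakly_based R M"
  unfolding regularly_weakly_based_def
proof (intro allI impI)
  fix X assume X: "generating_set R M X"
  define P where "P Y \<longleftrightarrow> Y \<subseteq> X \<and> finite Y \<and> generating_set R M Y" for Y
  obtain A where "P A"
    using finitely_generated_imp_finite_generating_subset[OF assms X] by (auto simp: P_def)
  then obtain Y where Y: "P Y" and least: "\<And>Z. P Z \<Longrightarrow> card Y \<le> card Z"
    using ex_has_least_nat[of P A card] by blast
  have "weakly_independent R M Y"
    unfolding weakly_independent_def
  proof (intro conjI ballI notI)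
    show "Y \<subseteq> carrier M" using Y by (auto simp: P_def generating_set_def)
    fix x assume x: "x \<in> Y" "x \<in> mod_span R M (Y - {x})"
    then have "P (Y - {x})" using Y generating_set_remove by (auto simp: P_def)
    then have "card Y \<le> card (Y - {x})" by (rule least)
    moreover have "card (Y - {x}) < card Y"
      using x Y by (intro card_Diff1_less) (auto simp: P_def)
    ultimately show False by simp
  qed
  then show "\<exists>Y\<subseteq>X. weak_basis R M Y" using Y by (auto simp: P_def weak_basis_def)
qed

end

definition radical_multiples :: "('a, 'r) ring_scheme \<Rightarrow> ('a, 'm) module \<Rightarrow> 'm set" where
  "radical_multiples R M =
     {j \<odot>\<^bsub>M\<^esub> y | j y. j \<in> jacobson_radical R \<and> y \<in> carrier M}"

context right_module
begin

lemma radical_multiples_subset: "radical_multiples R M \<subseteq> carrier M"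
  by (auto simp: radical_multiples_def R.jacobson_radical_closed smult_closed)

text \<open>
  Nakayama's lemma without finite generation.  Suppose \<open>y c \<notin> N\<close>.  As \<open>y\<close> is, modulo \<open>N\<close>, a sum of
  radical multiples \<open>z j\<close>, one of the \<open>z (j c)\<close> lies outside \<open>N\<close>.  Starting with \<open>c = 1\<close> this can be
  repeated forever and produces a sequence in the radical with nonvanishing products.
\<close>

lemma radical_Nakayama:
  assumes T: "T_nilpotent R (jacobson_radical R)"
    and N: "submodule N R M" and gen: "carrier M \<subseteq> mod_span R M (N \<union> radical_multiples R M)"
  shows "N = carrier M"
proof (rule ccontr)
  assume "N \<noteq> carrier M"
  then obtain y0 where y0: "y0 \<in> carrier M" "y0 \<notin> N" using submodule_subset[OF N] by blast
  note J = R.jacobson_radical_closed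
  have step: "\<exists>z\<in>carrier M. \<exists>j\<in>jacobson_radical R. (j \<otimes>\<^bsub>R\<^esub> c) \<odot>\<^bsub>M\<^esub> z \<notin> N"
    if y: "y \<in> carrier M" and c: "c \<in> carrier R" and yc: "c \<odot>\<^bsub>M\<^esub> y \<notin> N" for y c
  proof (rule ccontr)
    assume no: "\<not> ?thesis"
    \<comment> \<open>quantifying over \<open>r\<close> makes this set closed under scalars\<close>
    let ?V = "{v \<in> carrier M. \<forall>r\<in>carrier R. c \<odot>\<^bsub>M\<^esub> (r \<odot>\<^bsub>M\<^esub> v) \<in> N}"
    have "submodule ?V R M"
    proof (rule right_submoduleI)
      show "\<zero>\<^bsub>M\<^esub> \<in> ?V" using c submodule_zero[OF N] by (simp add: smult_zero_right)
      show "x \<oplus>\<^bsub>M\<^esub> y \<in> ?V" if "x \<in> ?V" "y \<in> ?V" for x y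
        using that c submodule_add[OF N] by (simp add: smult_vector_distr smult_closed)
      show "a \<odot>\<^bsub>M\<^esub> x \<in> ?V" if "a \<in> carrier R" "x \<in> ?V" for a x
        using that by (simp add: smult_closed flip: smult_assoc)
    qed auto
    moreover have "N \<union> radical_multiples R M \<subseteq> ?V"
    proof
      fix v assume "v \<in> N \<union> radical_multiples R M"
      then show "v \<in> ?V"
      proof
        assume "v \<in> N"
        then show ?thesis using c submodule_subset[OF N] submodule_smult[OF N] by auto
      next
        assume "v \<in> radical_multiples R M"
        then obtain j z where jz: "j \<in> jacobson_radical R" "z \<in> carrier M" "v = j \<odot>\<^bsub>M\<^esub> z"
          by (auto simp: radical_multiples_def)
        have "c \<odot>\<^bsub>M\<^esub> (r \<odot>\<^bsub>M\<^esub> v) = ((j \<otimes>\<^bsub>R\<^esub> r) \<otimes>\<^bsub>R\<^esub> c) \<odot>\<^bsub>M\<^esub> z" if "r \<in> carrier R" for r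
          using that jz c J by (simp add: smult_assoc)
        then show ?thesis
          using no jz J R.jacobson_radical_right_ideal by (auto simp: smult_closed)
      qed
    qed
    ultimately have "y \<in> ?V" using gen y span_minimal by blast
    then have "c \<odot>\<^bsub>M\<^esub> (\<one>\<^bsub>R\<^esub> \<odot>\<^bsub>M\<^esub> y) \<in> N" by blast
    then show False using yc y by (simp add: smult_one)
  qed
  let ?P = "\<lambda>n (y, c). y \<in> carrier M \<and> c \<in> carrier R \<and> c \<odot>\<^bsub>M\<^esub> y \<notin> N \<and> (n = 0 \<longrightarrow> c = \<one>\<^bsub>R\<^esub>)"
  let ?Q = "\<lambda>n (y, c) (z, c'). \<exists>j\<in>jacobson_radical R. c' = j \<otimes>\<^bsub>R\<^esub> c"
  have "\<exists>s. \<forall>n. ?P n (s n) \<and> ?Q n (s n) (s (Suc n))"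
  proof (rule dependent_nat_choice)
    show "\<exists>s. ?P 0 s" using y0 by (intro exI[of _ "(y0, \<one>\<^bsub>R\<^esub>)"]) (simp add: smult_one)
    fix s and n :: nat assume P: "?P n s"
    obtain y c where s: "s = (y, c)" by fastforce
    have yc: "y \<in> carrier M" "c \<in> carrier R" "c \<odot>\<^bsub>M\<^esub> y \<notin> N" using P by (simp_all add: s)
    obtain z j where z: "z \<in> carrier M" "j \<in> jacobson_radical R" "(j \<otimes>\<^bsub>R\<^esub> c) \<odot>\<^bsub>M\<^esub> z \<notin> N"
      using step[OF yc] by blast
    have "?P (Suc n) (z, j \<otimes>\<^bsub>R\<^esub> c)" using z yc J by simp
    moreover have "?Q n s (z, j \<otimes>\<^bsub>R\<^esub> c)" using z(2) by (auto simp: s intro!: bexI[of _ j])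
    ultimately show "\<exists>t. ?P (Suc n) t \<and> ?Q n s t" by (intro exI conjI)
  qed
  then obtain s where "\<forall>n. ?P n (s n) \<and> ?Q n (s n) (s (Suc n))" by (rule exE)
  then have s: "?P n (s n)" "?Q n (s n) (s (Suc n))" for n by simp_all
  define c where "c n = snd (s n)" for n
  have "\<forall>n. \<exists>j\<in>jacobson_radical R. c (Suc n) = j \<otimes>\<^bsub>R\<^esub> c n"
    using s(2) by (simp add: c_def split_beta)
  then obtain a where a: "\<And>n. a n \<in> jacobson_radical R" "\<And>n. c (Suc n) = a n \<otimes>\<^bsub>R\<^esub> c n"
    by metis
  have "leftward_prod R a 0 n = c n" for n
    by (induction n) (use s(1)[of 0] a in \<open>auto simp: c_def split_beta\<close>)
  then obtain n where "c n = \<zero>\<^bsub>R\<^esub>"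
    using T a(1) unfolding T_nilpotent_def by metis
  moreover have "c n \<odot>\<^bsub>M\<^esub> fst (s n) \<notin> N" "fst (s n) \<in> carrier M"
    using s(1)[of n] by (simp_all add: c_def split_beta)
  ultimately show False
    using submodule_zero[OF N] smult_zero_left by metis
qed

end


section \<open>Direct sums of principal right ideals\<close>

lemma right_module_hom_closed:
  "h \<in> right_module_hom R A B \<Longrightarrow> x \<in> carrier A \<Longrightarrow> h x \<in> carrier B"
  and right_module_hom_add: "h \<in> right_module_hom R A B \<Longrightarrow> x \<in> carrier A \<Longrightarrow> y \<in> carrier A \<Longrightarrow>
    h (x \<oplus>\<^bsub>A\<^esub> y) = h x \<oplus>\<^bsub>B\<^esub> h y"
  and right_module_hom_smult: "h \<in> right_module_hom R A B \<Longrightarrow> a \<in> carrier R \<Longrightarrow> x \<in> carrier A \<Longrightarrow>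
    h (a \<odot>\<^bsub>A\<^esub> x) = a \<odot>\<^bsub>B\<^esub> h x"
  by (auto simp: right_module_hom_def hom_def)

lemma right_module_homI:
  assumes "\<And>x. x \<in> carrier A \<Longrightarrow> h x \<in> carrier B"
    and "\<And>x y. x \<in> carrier A \<Longrightarrow> y \<in> carrier A \<Longrightarrow> h (x \<oplus>\<^bsub>A\<^esub> y) = h x \<oplus>\<^bsub>B\<^esub> h y"
    and "\<And>a x. a \<in> carrier R \<Longrightarrow> x \<in> carrier A \<Longrightarrow> h (a \<odot>\<^bsub>A\<^esub> x) = a \<odot>\<^bsub>B\<^esub> h x"
  shows "h \<in> right_module_hom R A B"
  using assms by (auto simp: right_module_hom_def hom_def)

lemma right_module_hom_zero:
  assumes "right_module R A" "right_module R B" "h \<in> right_module_hom R A B"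
  shows "h \<zero>\<^bsub>A\<^esub> = \<zero>\<^bsub>B\<^esub>"
proof -
  interpret A: right_module R A by fact
  interpret B: right_module R B by fact
  have "h \<zero>\<^bsub>A\<^esub> = h (\<zero>\<^bsub>R\<^esub> \<odot>\<^bsub>A\<^esub> \<zero>\<^bsub>A\<^esub>)" by (simp add: A.smult_zero_left)
  also have "\<dots> = \<zero>\<^bsub>R\<^esub> \<odot>\<^bsub>B\<^esub> h \<zero>\<^bsub>A\<^esub>" by (simp add: right_module_hom_smult[OF assms(3)])
  also have "\<dots> = \<zero>\<^bsub>B\<^esub>" by (simp add: B.smult_zero_left right_module_hom_closed[OF assms(3)])
  finally show ?thesis .
qed

lemma submodule_hom_image:
  assumes A: "right_module R A" and B: "right_module R B" and h: "h \<in> right_module_hom R A B"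
  shows "submodule (h ` carrier A) R B"
proof -
  interpret A: right_module R A by fact
  interpret B: right_module R B by fact
  show ?thesis
  proof (rule B.right_submoduleI)
    show "h ` carrier A \<subseteq> carrier B" using right_module_hom_closed[OF h] by blast
    show "\<zero>\<^bsub>B\<^esub> \<in> h ` carrier A"
      using right_module_hom_zero[OF A B h] A.M.zero_closed by (intro image_eqI[of _ _ "\<zero>\<^bsub>A\<^esub>"]) simp_all
    fix u assume "u \<in> h ` carrier A"
    then obtain x where x: "x \<in> carrier A" "u = h x" by (rule imageE)
    show "a \<odot>\<^bsub>B\<^esub> u \<in> h ` carrier A" if "a \<in> carrier R" for a
      using that x right_module_hom_smult[OF h] A.smult_closed
      by (intro image_eqI[of _ _ "a \<odot>\<^bsub>A\<^esub> x"]) simp_all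
    fix v assume "v \<in> h ` carrier A"
    then obtain y where y: "y \<in> carrier A" "v = h y" by (rule imageE)
    show "u \<oplus>\<^bsub>B\<^esub> v \<in> h ` carrier A"
      using x y right_module_hom_add[OF h] by (intro image_eqI[of _ _ "x \<oplus>\<^bsub>A\<^esub> y"]) simp_all
  qed
qed

lemma submodule_hom_preimage:
  assumes A: "right_module R A" and B: "right_module R B" and h: "h \<in> right_module_hom R A B"
    and N: "submodule N R B"
  shows "submodule {x \<in> carrier A. h x \<in> N} R A"
proof -
  interpret A: right_module R A by fact
  interpret B: right_module R B by fact
  show ?thesis
    by (rule A.right_submoduleI)
      (auto simp: right_module_hom_zero[OF A B h] right_module_hom_add[OF h]
        right_module_hom_smult[OF h] B.submodule_zero[OF N] B.submodule_add[OF N]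
        B.submodule_smult[OF N] A.smult_closed)
qed

lemma submodule_hom_equalizer:
  assumes A: "right_module R A" and B: "right_module R B"
    and h: "h \<in> right_module_hom R A B" and k: "k \<in> right_module_hom R A B"
  shows "submodule {x \<in> carrier A. h x = k x} R A"
proof -
  interpret A: right_module R A by fact
  interpret B: right_module R B by fact
  show ?thesis
    by (rule A.right_submoduleI)
      (auto simp: right_module_hom_zero[OF A B] right_module_hom_add[OF h] right_module_hom_add[OF k]
        right_module_hom_smult[OF h] right_module_hom_smult[OF k] h k A.smult_closed)
qed

definition ring_as_module :: "('a, 'r) ring_scheme \<Rightarrow> ('a, 'a) module" where
  "ring_as_module R = \<lparr>carrier = carrier R, mult = mult R, one = one R, zero = zero R, add = add R,
     smult = (\<lambda>a x. x \<otimes>\<^bsub>R\<^esub> a)\<rparr>"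

lemma (in ring) ring_as_module: "right_module R (ring_as_module R)"
proof -
  have "abelian_group (ring_as_module R)"
    by (rule abelian_groupI)
      (auto simp: ring_as_module_def a_ac intro: bexI[of _ "\<ominus> x" for x] l_neg)
  then show ?thesis
    using ring_axioms
    by (auto simp: right_module_def right_module_axioms_def ring_as_module_def l_distr r_distr m_assoc)
qed

text \<open>
  The direct sum of the right ideals \<open>f x R\<close>, as a module of finitely supported functions.  For
  idempotent \<open>f x\<close> the condition \<open>f x \<otimes> \<phi> x = \<phi> x\<close> expresses \<open>\<phi> x \<in> f x R\<close>.  With values of \<open>f\<close> in
  \<open>{0, 1}\<close> it is a free module.
\<close>

definition ideal_sum :: "('a, 'r) ring_scheme \<Rightarrow> ('x \<Rightarrow> 'a) \<Rightarrow> ('a, 'x \<Rightarrow> 'a) module" where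
  "ideal_sum R f = \<lparr>
     carrier = {\<phi>. (\<forall>x. \<phi> x \<in> carrier R \<and> f x \<otimes>\<^bsub>R\<^esub> \<phi> x = \<phi> x) \<and> finite {x. \<phi> x \<noteq> \<zero>\<^bsub>R\<^esub>}},
     mult = (\<lambda>\<phi> \<psi>. \<phi>), one = (\<lambda>_. \<zero>\<^bsub>R\<^esub>), zero = (\<lambda>_. \<zero>\<^bsub>R\<^esub>),
     add = (\<lambda>\<phi> \<psi> x. \<phi> x \<oplus>\<^bsub>R\<^esub> \<psi> x),
     smult = (\<lambda>a \<phi> x. \<phi> x \<otimes>\<^bsub>R\<^esub> a)\<rparr>"

definition single :: "('a, 'r) ring_scheme \<Rightarrow> 'x \<Rightarrow> 'a \<Rightarrow> 'x \<Rightarrow> 'a" where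
  "single R x r = (\<lambda>y. if y = x then r else \<zero>\<^bsub>R\<^esub>)"

definition combination ::
    "('a, 'r) ring_scheme \<Rightarrow> ('a, 'm) module \<Rightarrow> ('x \<Rightarrow> 'm) \<Rightarrow> ('x \<Rightarrow> 'a) \<Rightarrow> 'm" where
  "combination R M g \<phi> = (\<Oplus>\<^bsub>M\<^esub>x\<in>{x. \<phi> x \<noteq> \<zero>\<^bsub>R\<^esub>}. \<phi> x \<odot>\<^bsub>M\<^esub> g x)"

lemma ideal_sum_simps:
  "zero (ideal_sum R f) = (\<lambda>_. \<zero>\<^bsub>R\<^esub>)"
  "add (ideal_sum R f) = (\<lambda>\<phi> \<psi> x. \<phi> x \<oplus>\<^bsub>R\<^esub> \<psi> x)"
  "smult (ideal_sum R f) = (\<lambda>a \<phi> x. \<phi> x \<otimes>\<^bsub>R\<^esub> a)"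
  by (simp_all add: ideal_sum_def)

lemma ideal_sum_carrier:
  "\<phi> \<in> carrier (ideal_sum R f) \<longleftrightarrow>
     (\<forall>x. \<phi> x \<in> carrier R \<and> f x \<otimes>\<^bsub>R\<^esub> \<phi> x = \<phi> x) \<and> finite {x. \<phi> x \<noteq> \<zero>\<^bsub>R\<^esub>}"
  by (simp add: ideal_sum_def)

context ring
begin

lemma ideal_sum_module:
  assumes f: "\<And>x. f x \<in> carrier R"
  shows "right_module R (ideal_sum R f)"
proof -
  let ?C = "carrier (ideal_sum R f)"
  have add: "(\<lambda>x. \<phi> x \<oplus> \<psi> x) \<in> ?C" if "\<phi> \<in> ?C" "\<psi> \<in> ?C" for \<phi> \<psi>
  proof -
    have "{x. \<phi> x \<oplus> \<psi> x \<noteq> \<zero>} \<subseteq> {x. \<phi> x \<noteq> \<zero>} \<union> {x. \<psi> x \<noteq> \<zero>}" by auto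
    then show ?thesis
      using that f by (auto simp: ideal_sum_carrier r_distr intro: finite_subset)
  qed
  have smult: "(\<lambda>x. \<phi> x \<otimes> a) \<in> ?C" if "\<phi> \<in> ?C" "a \<in> carrier R" for \<phi> a
  proof -
    have "{x. \<phi> x \<otimes> a \<noteq> \<zero>} \<subseteq> {x. \<phi> x \<noteq> \<zero>}" using that by auto
    then show ?thesis
      using that f by (auto simp: ideal_sum_carrier intro: finite_subset simp flip: m_assoc)
  qed
  have "abelian_group (ideal_sum R f)"
  proof (rule abelian_groupI)
    fix \<phi> assume \<phi>: "\<phi> \<in> ?C"
    have "(\<lambda>x. \<phi> x \<otimes> \<ominus> \<one>) \<in> ?C" using smult[OF \<phi>] by simp
    moreover have "(\<lambda>x. \<phi> x \<otimes> \<ominus> \<one> \<oplus> \<phi> x) = (\<lambda>_. \<zero>)"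
      using \<phi> by (auto simp: ideal_sum_carrier r_minus l_neg)
    ultimately show "\<exists>\<psi>\<in>?C. \<psi> \<oplus>\<^bsub>ideal_sum R f\<^esub> \<phi> = \<zero>\<^bsub>ideal_sum R f\<^esub>"
      by (auto simp: ideal_sum_simps)
  qed (use add in \<open>auto simp: ideal_sum_simps ideal_sum_carrier a_ac f\<close>)
  then show ?thesis
    using ring_axioms add smult
    by (auto simp: right_module_def right_module_axioms_def ideal_sum_simps)
      (auto simp: ideal_sum_carrier l_distr r_distr m_assoc)
qed

lemma single_in_ideal_sum:
  assumes "\<And>x. f x \<in> carrier R" "r \<in> carrier R" "f x \<otimes> r = r"
  shows "single R x r \<in> carrier (ideal_sum R f)"
proof -
  have "{y. single R x r y \<noteq> \<zero>} \<subseteq> {x}" by (auto simp: single_def)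
  then show ?thesis
    using assms by (auto simp: ideal_sum_carrier single_def intro: finite_subset)
qed

text \<open>
  Every element is the sum of its components, so membership in a submodule may be tested on these.
\<close>

lemma ideal_sum_induct:
  assumes f: "\<And>x. f x \<in> carrier R" and N: "submodule N R (ideal_sum R f)"
    and \<phi>: "\<phi> \<in> carrier (ideal_sum R f)" and single: "\<And>x. single R x (\<phi> x) \<in> N"
  shows "\<phi> \<in> N"
proof -
  interpret S: right_module R "ideal_sum R f" by (rule ideal_sum_module[OF f])
  have "(\<lambda>x. if x \<in> A then \<phi> x else \<zero>) \<in> N" if "finite A" for A
    using that
  proof induction
    case empty
    then show ?case using S.submodule_zero[OF N] by (simp add: ideal_sum_simps)
  next
    case (insert x A)
    have "(\<lambda>y. if y \<in> insert x A then \<phi> y else \<zero>)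
        = single R x (\<phi> x) \<oplus>\<^bsub>ideal_sum R f\<^esub> (\<lambda>y. if y \<in> A then \<phi> y else \<zero>)"
      using \<phi> insert.hyps by (auto simp: ideal_sum_simps single_def ideal_sum_carrier fun_eq_iff)
    then show ?case using S.submodule_add[OF N single insert.IH] by simp
  qed
  from this[of "{x. \<phi> x \<noteq> \<zero>}"] have "(\<lambda>x. if x \<in> {x. \<phi> x \<noteq> \<zero>} then \<phi> x else \<zero>) \<in> N"
    using \<phi> by (simp add: ideal_sum_carrier)
  also have "(\<lambda>x. if x \<in> {x. \<phi> x \<noteq> \<zero>} then \<phi> x else \<zero>) = \<phi>" by auto
  finally show ?thesis .
qed

end

context right_module
begin

lemma combination_superset:
  assumes \<phi>: "\<And>x. \<phi> x \<in> carrier R" and g: "\<And>x. g x \<in> carrier M"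
    and A: "finite A" "{x. \<phi> x \<noteq> \<zero>\<^bsub>R\<^esub>} \<subseteq> A"
  shows "combination R M g \<phi> = (\<Oplus>\<^bsub>M\<^esub>x\<in>A. \<phi> x \<odot>\<^bsub>M\<^esub> g x)"
  unfolding combination_def using A \<phi> g smult_zero_left
  by (intro M.add.finprod_mono_neutral_cong_left) (auto intro!: smult_closed)

lemma combination_single:
  assumes "r \<in> carrier R" and g: "\<And>x. g x \<in> carrier M"
  shows "combination R M g (single R x r) = r \<odot>\<^bsub>M\<^esub> g x"
proof -
  have "combination R M g (single R x r) = (\<Oplus>\<^bsub>M\<^esub>y\<in>{x}. single R x r y \<odot>\<^bsub>M\<^esub> g y)"
    using assms by (intro combination_superset) (auto simp: single_def)
  also have "\<dots> = r \<odot>\<^bsub>M\<^esub> g x"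
    using assms by (simp add: single_def smult_closed)
  finally show ?thesis .
qed

lemma combination_hom:
  assumes f: "\<And>x. f x \<in> carrier R" and g: "\<And>x. g x \<in> carrier M"
  shows "combination R M g \<in> right_module_hom R (ideal_sum R f) M"
proof (rule right_module_homI)
  fix \<phi> assume \<phi>: "\<phi> \<in> carrier (ideal_sum R f)"
  then show "combination R M g \<phi> \<in> carrier M"
    unfolding combination_def using g
    by (intro M.finsum_closed) (auto simp: ideal_sum_carrier smult_closed)
  show "combination R M g (a \<odot>\<^bsub>ideal_sum R f\<^esub> \<phi>) = a \<odot>\<^bsub>M\<^esub> combination R M g \<phi>"
    if a: "a \<in> carrier R" for a
  proof -
    let ?A = "{x. \<phi> x \<noteq> \<zero>\<^bsub>R\<^esub>}"
    have "combination R M g (a \<odot>\<^bsub>ideal_sum R f\<^esub> \<phi>) = (\<Oplus>\<^bsub>M\<^esub>x\<in>?A. (\<phi> x \<otimes>\<^bsub>R\<^esub> a) \<odot>\<^bsub>M\<^esub> g x)"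
      using \<phi> a g unfolding ideal_sum_simps
      by (intro combination_superset) (auto simp: ideal_sum_carrier)
    also have "\<dots> = a \<odot>\<^bsub>M\<^esub> (\<Oplus>\<^bsub>M\<^esub>x\<in>A. \<phi> x \<odot>\<^bsub>M\<^esub> g x)" if "A = ?A" for A
    proof -
      have "(\<Oplus>\<^bsub>M\<^esub>x\<in>A. (\<phi> x \<otimes>\<^bsub>R\<^esub> a) \<odot>\<^bsub>M\<^esub> g x) = a \<odot>\<^bsub>M\<^esub> (\<Oplus>\<^bsub>M\<^esub>x\<in>A. \<phi> x \<odot>\<^bsub>M\<^esub> g x)" if "finite A" for A
        using that
      proof induction
        case empty
        then show ?case by (simp add: smult_zero_right a)
      next
        case (insert x A)
        then show ?case
          using \<phi> a g
          by (simp add: ideal_sum_carrier smult_closed smult_assoc smult_vector_distr)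
      qed
      then show ?thesis using that \<phi> by (simp add: ideal_sum_carrier)
    qed
    finally show ?thesis by (simp add: combination_def)
  qed
  fix \<psi> assume \<psi>: "\<psi> \<in> carrier (ideal_sum R f)"
  let ?A = "{x. \<phi> x \<noteq> \<zero>\<^bsub>R\<^esub>} \<union> {x. \<psi> x \<noteq> \<zero>\<^bsub>R\<^esub>}"
  have A: "finite ?A" and cl: "\<And>x. \<phi> x \<in> carrier R" "\<And>x. \<psi> x \<in> carrier R"
    using \<phi> \<psi> by (auto simp: ideal_sum_carrier)
  have "combination R M g (\<phi> \<oplus>\<^bsub>ideal_sum R f\<^esub> \<psi>) = (\<Oplus>\<^bsub>M\<^esub>x\<in>?A. (\<phi> x \<oplus>\<^bsub>R\<^esub> \<psi> x) \<odot>\<^bsub>M\<^esub> g x)"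
    using A cl g unfolding ideal_sum_simps by (intro combination_superset) auto
  also have "\<dots> = (\<Oplus>\<^bsub>M\<^esub>x\<in>?A. \<phi> x \<odot>\<^bsub>M\<^esub> g x \<oplus>\<^bsub>M\<^esub> \<psi> x \<odot>\<^bsub>M\<^esub> g x)"
    using cl g by (simp add: smult_scalar_distr)
  also have "\<dots> = (\<Oplus>\<^bsub>M\<^esub>x\<in>?A. \<phi> x \<odot>\<^bsub>M\<^esub> g x) \<oplus>\<^bsub>M\<^esub> (\<Oplus>\<^bsub>M\<^esub>x\<in>?A. \<psi> x \<odot>\<^bsub>M\<^esub> g x)"
    using cl g by (intro M.finsum_addf) (auto simp: smult_closed)
  also have "\<dots> = combination R M g \<phi> \<oplus>\<^bsub>M\<^esub> combination R M g \<psi>"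
    using combination_superset[of \<phi> g ?A] combination_superset[of \<psi> g ?A] A cl g by simp
  finally show "combination R M g (\<phi> \<oplus>\<^bsub>ideal_sum R f\<^esub> \<psi>)
      = combination R M g \<phi> \<oplus>\<^bsub>M\<^esub> combination R M g \<psi>" .
qed

end

text \<open>
  A homomorphism on the direct sum is determined by the images of the elements \<open>single R x (f x)\<close>, and
  it is lifted by lifting these.
\<close>

lemma (in ring) ideal_sum_projective:
  assumes f: "\<And>x. f x \<in> carrier R" "\<And>x. f x \<otimes> f x = f x"
  shows "projective_module R (ideal_sum R f)"
  unfolding projective_module_def
proof (intro conjI allI impI)
  show S: "right_module R (ideal_sum R f)" by (rule ideal_sum_module[OF f(1)])
  fix A :: "('a, ('x \<Rightarrow> 'a) \<Rightarrow> 'a) module" and B :: "('a, 'x \<Rightarrow> 'a) module" and g h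
  assume "right_module R A \<and> right_module R B \<and> g \<in> right_module_epi R A B \<and>
    h \<in> right_module_hom R (ideal_sum R f) B"
  then have A: "right_module R A" and B: "right_module R B" and g: "g \<in> right_module_hom R A B"
    and surj: "g ` carrier A = carrier B" and h: "h \<in> right_module_hom R (ideal_sum R f) B"
    by (auto simp: right_module_epi_def)
  interpret A: right_module R A by fact
  interpret B: right_module R B by fact
  have gen: "single R x (f x) \<in> carrier (ideal_sum R f)" for x
    using single_in_ideal_sum[of f "f x" x] f by simp
  then have "\<forall>x. \<exists>a\<in>carrier A. g a = h (single R x (f x))"
    using right_module_hom_closed[OF h] surj by (metis imageE)
  then obtain a where a: "\<And>x. a x \<in> carrier A" "\<And>x. g (a x) = h (single R x (f x))"
    by metis
  let ?k = "combination R A a"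
  have k: "?k \<in> right_module_hom R (ideal_sum R f) A" using f(1) a(1) by (rule A.combination_hom)
  have gk: "g \<circ> ?k \<in> right_module_hom R (ideal_sum R f) B"
    using right_module_hom_closed[OF k]
    by (intro right_module_homI)
      (auto simp: right_module_hom_closed[OF g] right_module_hom_add[OF g] right_module_hom_smult[OF g]
        right_module_hom_add[OF k] right_module_hom_smult[OF k])
  have "\<phi> \<in> {\<phi> \<in> carrier (ideal_sum R f). (g \<circ> ?k) \<phi> = h \<phi>}"
    if \<phi>: "\<phi> \<in> carrier (ideal_sum R f)" for \<phi>
  proof (rule ideal_sum_induct[OF _ submodule_hom_equalizer[OF S B gk h] \<phi>])
    show "f x \<in> carrier R" for x by (rule f(1))
    fix x
    have \<phi>x: "\<phi> x \<in> carrier R" "f x \<otimes> \<phi> x = \<phi> x" using \<phi> by (auto simp: ideal_sum_carrier)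
    have "single R x (\<phi> x) = \<phi> x \<odot>\<^bsub>ideal_sum R f\<^esub> single R x (f x)"
      using \<phi>x by (auto simp: single_def ideal_sum_simps)
    then have "h (single R x (\<phi> x)) = \<phi> x \<odot>\<^bsub>B\<^esub> g (a x)"
      using \<phi>x a gen by (simp add: right_module_hom_smult[OF h])
    also have "\<dots> = g (?k (single R x (\<phi> x)))"
      using \<phi>x a by (simp add: A.combination_single right_module_hom_smult[OF g])
    finally show "single R x (\<phi> x) \<in> {\<phi> \<in> carrier (ideal_sum R f). (g \<circ> ?k) \<phi> = h \<phi>}"
      using single_in_ideal_sum[of f, OF f(1) \<phi>x] by simp
  qed
  then show "\<exists>k\<in>right_module_hom R (ideal_sum R f) A. \<forall>\<phi>\<in>carrier (ideal_sum R f). g (k \<phi>) = h \<phi>"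
    using k by auto
qed

text \<open>
  A functional with prescribed values on a basis exists because a free module is isomorphic to a module of
  finitely supported functions: \<open>?p\<close> is the isomorphism, \<open>c\<close> its inverse, and \<open>?q\<close> the functional in
  coordinates.
\<close>

lemma (in right_module) free_module_functional:
  assumes S: "linearly_independent R M S" "generating_set R M S"
    and g: "\<And>s. s \<in> S \<Longrightarrow> g s \<in> carrier R"
  shows "\<exists>h\<in>right_module_hom R M (ring_as_module R). \<forall>s\<in>S. h s = g s"
proof -
  define f where "f x = (if x \<in> S then \<one>\<^bsub>R\<^esub> else \<zero>\<^bsub>R\<^esub>)" for x
  define v where "v x = (if x \<in> S then x else \<zero>\<^bsub>M\<^esub>)" for x
  define w where "w x = (if x \<in> S then g x else \<zero>\<^bsub>R\<^esub>)" for x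
  have SM: "S \<subseteq> carrier M" using S by (simp add: generating_set_def)
  have f: "f x \<in> carrier R" and v: "v x \<in> carrier M" and w: "w x \<in> carrier (ring_as_module R)" for x
    using SM g by (auto simp: f_def v_def w_def ring_as_module_def)
  let ?F = "ideal_sum R f"
  interpret F: right_module R ?F by (rule R.ideal_sum_module[OF f])
  interpret RR: right_module R "ring_as_module R" by (rule R.ring_as_module)
  let ?p = "combination R M v" and ?q = "combination R (ring_as_module R) w"
  have p: "?p \<in> right_module_hom R ?F M" by (rule combination_hom[OF f v])
  have q: "?q \<in> right_module_hom R ?F (ring_as_module R)" by (rule RR.combination_hom[OF f w])
  have e: "single R s \<one>\<^bsub>R\<^esub> \<in> carrier ?F" "?p (single R s \<one>\<^bsub>R\<^esub>) = s" "?q (single R s \<one>\<^bsub>R\<^esub>) = g s"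
    if "s \<in> S" for s
  proof -
    show "single R s \<one>\<^bsub>R\<^esub> \<in> carrier ?F"
      using that by (intro R.single_in_ideal_sum[OF f]) (auto simp: f_def)
    show "?p (single R s \<one>\<^bsub>R\<^esub>) = s"
      using that SM combination_single[of "\<one>\<^bsub>R\<^esub>" v s] v by (auto simp: v_def smult_one)
    show "?q (single R s \<one>\<^bsub>R\<^esub>) = g s"
      using that RR.combination_single[of "\<one>\<^bsub>R\<^esub>" w s] RR.smult_one[OF w, of s] w
      by (simp add: w_def)
  qed
  have "S \<subseteq> ?p ` carrier ?F" using e by (metis imageI subsetI)
  then have "mod_span R M S \<subseteq> ?p ` carrier ?F"
    by (rule span_minimal[OF _ submodule_hom_image[OF F.right_module_axioms right_module_axioms p]])
  then have surj: "?p ` carrier ?F = carrier M"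
    using S right_module_hom_closed[OF p] by (auto simp: generating_set_def)
  have ker: "\<phi> = \<zero>\<^bsub>?F\<^esub>" if \<phi>: "\<phi> \<in> carrier ?F" "?p \<phi> = \<zero>\<^bsub>M\<^esub>" for \<phi>
  proof -
    let ?A = "{x. \<phi> x \<noteq> \<zero>\<^bsub>R\<^esub>}"
    have cl: "\<phi> x \<in> carrier R" "f x \<otimes>\<^bsub>R\<^esub> \<phi> x = \<phi> x" and fin: "finite ?A" for x
      using \<phi> by (auto simp: ideal_sum_carrier)
    have AS: "?A \<subseteq> S"
    proof
      fix x assume "x \<in> ?A"
      then show "x \<in> S" using cl[of x] by (cases "x \<in> S") (auto simp: f_def)
    qed
    have "(\<Oplus>\<^bsub>M\<^esub>x\<in>?A. \<phi> x \<odot>\<^bsub>M\<^esub> x) = ?p \<phi>"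
      unfolding combination_def using AS SM cl
      by (intro M.finsum_cong') (auto simp: v_def subset_iff intro!: smult_closed)
    then have "(\<Oplus>\<^bsub>M\<^esub>x\<in>?A. \<phi> x \<odot>\<^bsub>M\<^esub> x) = \<zero>\<^bsub>M\<^esub>" using \<phi>(2) by (rule trans)
    moreover have "\<phi> \<in> ?A \<rightarrow> carrier R" using cl by (intro Pi_I)
    ultimately have "\<forall>x\<in>?A. \<phi> x = \<zero>\<^bsub>R\<^esub>"
      using S(1)[unfolded linearly_independent_def, THEN conjunct2, THEN spec[of _ ?A], THEN spec[of _ \<phi>]]
        AS fin by (elim mp) (intro conjI)
    then show ?thesis by (auto simp: ideal_sum_simps)
  qed
  have inj: "\<phi> = \<psi>" if \<phi>: "\<phi> \<in> carrier ?F" and \<psi>: "\<psi> \<in> carrier ?F" and eq: "?p \<phi> = ?p \<psi>" for \<phi> \<psi>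
  proof -
    have m: "\<ominus>\<^bsub>R\<^esub> \<one>\<^bsub>R\<^esub> \<odot>\<^bsub>?F\<^esub> \<psi> \<in> carrier ?F" using F.smult_closed \<psi> by simp
    have "?p (\<phi> \<oplus>\<^bsub>?F\<^esub> \<ominus>\<^bsub>R\<^esub> \<one>\<^bsub>R\<^esub> \<odot>\<^bsub>?F\<^esub> \<psi>) = \<zero>\<^bsub>M\<^esub>"
      using \<phi> \<psi> m eq right_module_hom_closed[OF p \<psi>]
      by (simp add: right_module_hom_add[OF p] right_module_hom_smult[OF p] smult_minus_left smult_one M.r_neg)
    then have "\<phi> \<oplus>\<^bsub>?F\<^esub> \<ominus>\<^bsub>?F\<^esub> \<psi> = \<zero>\<^bsub>?F\<^esub>"
      using ker F.M.add.m_closed[OF \<phi> m] \<psi> by (simp add: F.smult_minus_left F.smult_one)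
    then show ?thesis
      using \<phi> \<psi> by (metis F.M.add.inv_closed F.M.minus_equality F.M.minus_minus)
  qed
  define c where "c = inv_into (carrier ?F) ?p"
  have c: "c x \<in> carrier ?F" "?p (c x) = x" if "x \<in> carrier M" for x
    using that surj by (auto simp: c_def inv_into_into f_inv_into_f)
  have cp: "c (?p \<phi>) = \<phi>" if "\<phi> \<in> carrier ?F" for \<phi>
    using inj c right_module_hom_closed[OF p] that by metis
  have c_hom: "c \<in> right_module_hom R M ?F"
  proof (rule right_module_homI)
    show "c (x \<oplus>\<^bsub>M\<^esub> y) = c x \<oplus>\<^bsub>?F\<^esub> c y" if "x \<in> carrier M" "y \<in> carrier M" for x y
      using cp[of "c x \<oplus>\<^bsub>?F\<^esub> c y"] c that by (simp add: right_module_hom_add[OF p])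
    show "c (a \<odot>\<^bsub>M\<^esub> x) = a \<odot>\<^bsub>?F\<^esub> c x" if "a \<in> carrier R" "x \<in> carrier M" for a x
      using cp[of "a \<odot>\<^bsub>?F\<^esub> c x"] c that by (simp add: right_module_hom_smult[OF p] F.smult_closed)
  qed (use c in auto)
  have "?q \<circ> c \<in> right_module_hom R M (ring_as_module R)"
    using right_module_hom_closed[OF c_hom]
    by (intro right_module_homI)
      (auto simp: right_module_hom_closed[OF q] right_module_hom_add[OF q] right_module_hom_smult[OF q]
        right_module_hom_add[OF c_hom] right_module_hom_smult[OF c_hom])
  moreover have "(?q \<circ> c) s = g s" if "s \<in> S" for s
    using e[OF that] cp[of "single R s \<one>\<^bsub>R\<^esub>"] by simp
  ultimately show ?thesis by blast
qed


section \<open>Regularly weakly based free modules\<close>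

lemma (in ring) principal_right_ideal_submodule:
  assumes b: "b \<in> carrier R"
  shows "submodule {b \<otimes> d | d. d \<in> carrier R} R (ring_as_module R)"
proof -
  interpret RR: right_module R "ring_as_module R" by (rule ring_as_module)
  define I where "I = {b \<otimes> d | d. d \<in> carrier R}"
  have I: "b \<otimes> d \<in> I" if "d \<in> carrier R" for d using that by (auto simp: I_def)
  have E: "\<exists>d\<in>carrier R. x = b \<otimes> d" if "x \<in> I" for x using that by (auto simp: I_def)
  have "submodule I R (ring_as_module R)"
  proof (rule RR.right_submoduleI)
    show "I \<subseteq> carrier (ring_as_module R)" using E b by (force simp: ring_as_module_def)
    show "\<zero>\<^bsub>ring_as_module R\<^esub> \<in> I"
      using I[OF zero_closed] b by (simp add: ring_as_module_def)
    fix x assume "x \<in> I"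
    then obtain d where d: "d \<in> carrier R" "x = b \<otimes> d" using E by blast
    show "a \<odot>\<^bsub>ring_as_module R\<^esub> x \<in> I" if "a \<in> carrier R" for a
      using I[of "d \<otimes> a"] that b d by (simp add: ring_as_module_def m_assoc)
    fix y assume "y \<in> I"
    then obtain d' where "d' \<in> carrier R" "y = b \<otimes> d'" using E by blast
    then show "x \<oplus>\<^bsub>ring_as_module R\<^esub> y \<in> I"
      using I[of "d \<oplus> d'"] b d by (simp add: ring_as_module_def r_distr)
  qed
  then show ?thesis by (simp add: I_def)
qed

text \<open>
  Choose distinct basis elements \<open>e 0, e 1, \<dots>\<close> and let \<open>x n = e (n+1) a n\<close> and \<open>y n = e n - x n\<close>.  These
  elements together with the rest \<open>S'\<close> of the basis generate the module, since \<open>e n = y n + x n\<close>.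
  Let \<open>Y\<close> be a weak basis among them.

  The set \<open>Y\<close> contains every \<open>y j\<close>.  To see this, use the functional \<open>l j\<close> that kills \<open>S'\<close> and the
  \<open>e n\<close> with \<open>n > j\<close> and maps \<open>e n\<close> to \<open>a (j-1) \<otimes> \<dots> \<otimes> a n\<close> otherwise.  It maps \<open>y j\<close> to \<open>1\<close> and every other
  generator into the right ideal generated by \<open>a (j-1)\<close>, which is proper (to \<open>0\<close> if \<open>j = 0\<close>).  This is where the choice
  of \<open>x n\<close> instead of the more obvious generator \<open>e n\<close> matters.

  Modulo the \<open>y j\<close>, each \<open>x n\<close> is a multiple of \<open>x m\<close> for all \<open>m \<ge> n\<close>.  By weak independence \<open>Y\<close> cannot
  contain \<open>x n\<close> for arbitrarily large \<open>n\<close>.  So for some \<open>N\<close> the module is generated by \<open>x N\<close>, the \<open>y j\<close>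
  and \<open>S'\<close>.  Expressing \<open>e (N+1)\<close> by these and applying \<open>l m\<close> for a large \<open>m\<close>, which kills the finitely
  many \<open>y j\<close> involved, gives the required equation.
\<close>

lemma (in right_module) regularly_weakly_based_imp_no_strict_bass_chain:
  assumes S: "linearly_independent R M S" "generating_set R M S" and inf: "infinite S"
    and rwb: "regularly_weakly_based R M"
  shows "no_strict_bass_chain R"
  unfolding no_strict_bass_chain_def
proof (intro allI impI)
  fix a :: "nat \<Rightarrow> 'a" assume a0: "\<forall>n. a n \<in> carrier R \<and> \<not> right_invertible R (a n)"
  then have a: "a n \<in> carrier R" and not_ri: "\<not> right_invertible R (a n)" for n by auto
  let ?RR = "ring_as_module R"
  interpret RR: right_module R ?RR by (rule R.ring_as_module)
  have SM: "S \<subseteq> carrier M" using S by (simp add: generating_set_def)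
  obtain e :: "nat \<Rightarrow> 'm" where e: "inj e" "range e \<subseteq> S"
    using infinite_countable_subset[OF inf] by blast
  have eM: "e n \<in> carrier M" for n using e SM by blast
  define S' where "S' = S - range e"
  have S'M: "S' \<subseteq> carrier M" using SM by (auto simp: S'_def)
  define x where "x n = a n \<odot>\<^bsub>M\<^esub> e (Suc n)" for n
  define y where "y n = e n \<ominus>\<^bsub>M\<^esub> x n" for n
  have xM: "x n \<in> carrier M" for n using a eM by (simp add: x_def smult_closed)
  have yM: "y n \<in> carrier M" for n using xM eM by (simp add: y_def)
  have e_eq: "e n = y n \<oplus>\<^bsub>M\<^esub> x n" for n
    using xM[of n] eM[of n] by (simp add: y_def M.minus_eq M.a_assoc M.l_neg)
  let ?P = "leftward_prod R a"
  have P: "?P n k \<in> carrier R" for n k by (rule R.leftward_prod_closed) (rule a)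
  define g where "g j s = (if s \<in> range e \<and> inv_into UNIV e s \<le> j then ?P (inv_into UNIV e s) (j - inv_into UNIV e s) else \<zero>\<^bsub>R\<^esub>)"
    for j s
  have "\<exists>h\<in>right_module_hom R M ?RR. \<forall>s\<in>S. h s = g j s" for j
    using P by (intro free_module_functional[OF S]) (simp add: g_def)
  then obtain l where l: "\<And>j. l j \<in> right_module_hom R M ?RR" and lg: "\<And>j s. s \<in> S \<Longrightarrow> l j s = g j s"
    by metis
  have l_closed: "l j v \<in> carrier R" if "v \<in> carrier M" for j v
    using right_module_hom_closed[OF l that] by (simp add: ring_as_module_def)
  have l_add: "l j (v \<oplus>\<^bsub>M\<^esub> w) = l j v \<oplus>\<^bsub>R\<^esub> l j w" if "v \<in> carrier M" "w \<in> carrier M" for j v w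
    using right_module_hom_add[OF l that] by (simp add: ring_as_module_def)
  have l_smult: "l j (c \<odot>\<^bsub>M\<^esub> v) = l j v \<otimes>\<^bsub>R\<^esub> c" if "c \<in> carrier R" "v \<in> carrier M" for j c v
    using right_module_hom_smult[OF l that] by (simp add: ring_as_module_def)
  have l_zero: "l j \<zero>\<^bsub>M\<^esub> = \<zero>\<^bsub>R\<^esub>" for j
    using right_module_hom_zero[OF right_module_axioms RR.right_module_axioms l]
    by (simp add: ring_as_module_def)
  have le: "l j (e n) = (if n \<le> j then ?P n (j - n) else \<zero>\<^bsub>R\<^esub>)" for j n
  proof -
    have "e n \<in> S" using e by blast
    then show ?thesis using lg[of "e n" j] e(1) by (auto simp: g_def)
  qed
  have lS': "l j s = \<zero>\<^bsub>R\<^esub>" if "s \<in> S'" for j s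
    using that lg by (auto simp: S'_def g_def)
  have lx: "l j (x n) = (if n < j then ?P n (j - n) else \<zero>\<^bsub>R\<^esub>)" for j n
  proof (cases "n < j")
    case True
    then have "j - n = 1 + (j - Suc n)" by simp
    then have "?P n (j - n) = ?P (n + 1) (j - Suc n) \<otimes>\<^bsub>R\<^esub> ?P n 1"
      using R.leftward_prod_add[of a n 1 "j - Suc n"] a by metis
    also have "?P n 1 = a n" using a[of n] by simp
    finally show ?thesis
      using True a[of n] eM by (simp add: x_def l_smult le)
  qed (use a eM in \<open>simp add: x_def l_smult le\<close>)
  have ly: "l j (y n) = (if n = j then \<one>\<^bsub>R\<^esub> else \<zero>\<^bsub>R\<^esub>)" for j n
  proof -
    let ?d = "if n = j then \<one>\<^bsub>R\<^esub> else \<zero>\<^bsub>R\<^esub>"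
    have "l j (y n) \<oplus>\<^bsub>R\<^esub> l j (x n) = l j (e n)"
      unfolding l_add[OF yM xM, symmetric] e_eq[symmetric] by (rule refl)
    also have "\<dots> = ?d \<oplus>\<^bsub>R\<^esub> l j (x n)"
      unfolding le lx using P[of n "j - n"] by (cases n j rule: linorder_cases) simp_all
    finally show ?thesis
      using l_closed[OF yM] l_closed[OF xM] R.add.right_cancel[of "l j (x n)" "l j (y n)" ?d] by simp
  qed
  \<comment> \<open>the values of \<open>l j\<close> on generators other than \<open>y j\<close> are right multiples of \<open>b j\<close>;
      for \<open>j = 0\<close> they vanish\<close>
  define b where "b j = (case j of 0 \<Rightarrow> \<zero>\<^bsub>R\<^esub> | Suc i \<Rightarrow> a i)" for j
  have b: "b j \<in> carrier R" for j using a by (simp add: b_def split: nat.split)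
  have b_ri: "b j \<otimes>\<^bsub>R\<^esub> d \<noteq> \<one>\<^bsub>R\<^esub>" if d: "d \<in> carrier R" for j d
  proof (cases j)
    case 0
    have "\<zero>\<^bsub>R\<^esub> \<noteq> \<one>\<^bsub>R\<^esub>"
    proof
      assume "\<zero>\<^bsub>R\<^esub> = \<one>\<^bsub>R\<^esub>"
      then have "a 0 \<otimes>\<^bsub>R\<^esub> \<zero>\<^bsub>R\<^esub> = \<one>\<^bsub>R\<^esub>" using R.r_null[OF a] by metis
      then show False using not_ri[of 0] by (auto simp: right_invertible_def)
    qed
    then show ?thesis using d by (simp add: b_def 0)
  next
    case (Suc i)
    then show ?thesis using d not_ri[of i] by (auto simp: b_def right_invertible_def)
  qed
  define I where "I j = {b j \<otimes>\<^bsub>R\<^esub> d | d. d \<in> carrier R}" for j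
  have multiple: "b j \<otimes>\<^bsub>R\<^esub> d \<in> I j" if "d \<in> carrier R" for j d
    using that by (auto simp: I_def)
  have zero_I: "\<zero>\<^bsub>R\<^esub> \<in> I j" for j
    using multiple[OF R.zero_closed, of j] by (simp only: R.r_null[OF b])
  have one_I: "\<one>\<^bsub>R\<^esub> \<notin> I j" for j
  proof
    assume "\<one>\<^bsub>R\<^esub> \<in> I j"
    then obtain d where "\<one>\<^bsub>R\<^esub> = b j \<otimes>\<^bsub>R\<^esub> d" "d \<in> carrier R" by (auto simp: I_def)
    then show False using b_ri[of d j] by simp
  qed
  have lxI: "l j (x n) \<in> I j" for j n
  proof (cases "n < j")
    case True
    then obtain i where i: "j = Suc i" "n \<le> i" by (cases j) auto
    then have "l j (x n) = b j \<otimes>\<^bsub>R\<^esub> ?P n (i - n)"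
      by (simp add: lx b_def Suc_diff_le)
    then show ?thesis using multiple[OF P] by simp
  next
    case False
    then show ?thesis using zero_I[of j] by (simp only: lx if_False)
  qed
  define X where "X = S' \<union> range x \<union> range y"
  have XM: "X \<subseteq> carrier M" using S'M xM yM by (auto simp: X_def)
  have "generating_set R M X"
  proof -
    have "s \<in> mod_span R M X" if s: "s \<in> S" for s
    proof (cases "s \<in> range e")
      case True
      then obtain n where n: "s = e n" by blast
      have "x n \<in> mod_span R M X" "y n \<in> mod_span R M X"
        by (auto intro!: span_inc simp: X_def)
      then show ?thesis
        unfolding n e_eq by (intro submodule_add[OF span_submodule[OF XM]])
    next
      case False
      then show ?thesis using s by (intro span_inc) (auto simp: X_def S'_def)
    qed
    then have "mod_span R M S \<subseteq> mod_span R M X" using span_subset_span[OF XM, of S] by blast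
    then show ?thesis
      using S(2) XM span_closed[OF XM] unfolding generating_set_def by blast
  qed
  then obtain Y where YX: "Y \<subseteq> X" and Y: "weak_basis R M Y"
    using rwb unfolding regularly_weakly_based_def by blast
  have YM: "Y \<subseteq> carrier M" "mod_span R M Y = carrier M"
    and indep: "\<And>v. v \<in> Y \<Longrightarrow> v \<notin> mod_span R M (Y - {v})"
    using Y by (auto simp: weak_basis_def generating_set_def weakly_independent_def)
  have yY: "y j \<in> Y" for j
  proof (rule ccontr)
    assume no: "y j \<notin> Y"
    let ?N = "{v \<in> carrier M. l j v \<in> I j}"
    have sub: "submodule ?N R M"
      unfolding I_def
      by (rule submodule_hom_preimage[OF right_module_axioms RR.right_module_axioms l
          R.principal_right_ideal_submodule[OF b]])
    have "l j v \<in> I j" if v: "v \<in> Y" for v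
    proof -
      consider "v \<in> S'" | n where "v = x n" | n where "v = y n" "n \<noteq> j"
        using v YX no unfolding X_def by blast
      then show ?thesis
        by cases (simp_all add: lS' lxI zero_I ly)
    qed
    then have "Y \<subseteq> ?N" using YM(1) by (intro subsetI CollectI conjI) (rule subsetD)
    then have "mod_span R M Y \<subseteq> ?N" using sub by (rule span_minimal)
    then have "y j \<in> ?N" using yM[of j] unfolding YM(2) by (rule subsetD)
    then show False using one_I[of j] by (simp add: ly)
  qed
  have down: "e n \<in> T" if T: "submodule T R M" "\<And>j. y j \<in> T" and "e m \<in> T" "n \<le> m" for T n m
    using that(4,3)
  proof (induction n rule: inc_induct)
    case base
    then show ?case .
  next
    case (step n)
    then have "x n \<in> T" unfolding x_def using submodule_smult[OF T(1) a] by blast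
    then show ?case by (subst e_eq) (rule submodule_add[OF T])
  qed
  have x_down: "x n \<in> T" if T: "submodule T R M" "\<And>j. y j \<in> T" and xm: "x m \<in> T" and nm: "n \<le> m"
    for T n m
  proof -
    have "e m \<in> T" by (subst e_eq) (rule submodule_add[OF T xm])
    then have "e n \<in> T" using down[OF T] nm by blast
    then have "e n \<oplus>\<^bsub>M\<^esub> \<ominus>\<^bsub>M\<^esub> y n \<in> T"
      using submodule_add[OF T(1)] submodule_minus[OF T(1) T(2)] by blast
    also have "e n \<oplus>\<^bsub>M\<^esub> \<ominus>\<^bsub>M\<^esub> y n = x n"
      using xM[of n] yM[of n] by (subst e_eq) (simp add: M.a_ac M.r_neg M.r_neg2)
    finally show ?thesis .
  qed
  have "\<exists>N. \<forall>n. x n \<in> Y \<longrightarrow> n \<le> N"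
  proof (rule ccontr)
    assume "\<not> ?thesis"
    then have unb: "\<exists>n>N. x n \<in> Y" for N by (meson not_le)
    then obtain n where n: "x n \<in> Y" by blast
    obtain m where m: "n < m" "x m \<in> Y" using unb by blast
    let ?T = "mod_span R M (Y - {x n})"
    have T: "submodule ?T R M" using YM by (intro span_submodule) blast
    have "y j \<in> ?T" for j
    proof -
      have "l j (y j) \<noteq> l j (x n)" using lxI[of j n] one_I[of j] by (auto simp: ly)
      then have "y j \<noteq> x n" by auto
      then show ?thesis using yY by (intro span_inc) blast
    qed
    moreover have "x m \<in> ?T"
    \<comment> \<open>equality of \<open>x m\<close> and \<open>x n\<close> is only possible if both are zero\<close>
    proof (cases "x m = x n")
      case True
      then have "l (Suc n) (x n) = l (Suc n) (x m)" by simp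
      then have "a n = \<zero>\<^bsub>R\<^esub>" using m a[of n] by (simp add: lx)
      then have "x n = \<zero>\<^bsub>M\<^esub>" using eM by (simp add: x_def smult_zero_left)
      then show ?thesis using submodule_zero[OF T] True by simp
    next
      case False
      then show ?thesis using m by (intro span_inc) blast
    qed
    ultimately have "x n \<in> ?T" using x_down[OF T] m by (meson less_imp_le)
    then show False using indep[OF n] by blast
  qed
  then obtain N where N: "\<And>n. x n \<in> Y \<Longrightarrow> n \<le> N" by blast
  define T0 where "T0 = S' \<union> range y"
  have T0M: "T0 \<subseteq> carrier M" using S'M yM by (auto simp: T0_def)
  let ?T = "mod_span R M (insert (x N) T0)"
  have T: "submodule ?T R M" using T0M xM by (intro span_submodule) simp
  have yT: "y j \<in> ?T" for j by (intro span_inc) (simp add: T0_def)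
  have "v \<in> ?T" if v: "v \<in> Y" for v
  proof -
    consider "v \<in> T0" | n where "v = x n" "n \<le> N"
      using v YX N unfolding X_def T0_def by blast
    then show ?thesis
    proof cases
      case 1
      then show ?thesis by (intro span_inc) simp
    next
      case 2
      have "x N \<in> ?T" by (intro span_inc) simp
      then show ?thesis using x_down[OF T yT] 2 by blast
    qed
  qed
  then have "carrier M \<subseteq> ?T" using span_minimal[OF _ T, of Y] YM by blast
  then obtain u r where u: "u \<in> mod_span R M T0" and r: "r \<in> carrier R"
    and eu: "e (Suc N) = u \<oplus>\<^bsub>M\<^esub> r \<odot>\<^bsub>M\<^esub> x N"
    using span_insert[OF T0M xM[of N]] eM by blast
  \<comment> \<open>elements of the span of \<open>S'\<close> and the \<open>y j\<close> are killed by almost all \<open>l m\<close>\<close>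
  let ?V = "{v \<in> carrier M. \<exists>m0. \<forall>m\<ge>m0. l m v = \<zero>\<^bsub>R\<^esub>}"
  have "submodule ?V R M"
  proof (rule right_submoduleI)
    show "\<zero>\<^bsub>M\<^esub> \<in> ?V" by (simp add: l_zero)
    show "c \<odot>\<^bsub>M\<^esub> v \<in> ?V" if "c \<in> carrier R" "v \<in> ?V" for c v
      using that by (fastforce simp: l_smult smult_closed)
    fix v w assume "v \<in> ?V" "w \<in> ?V"
    then obtain m1 m2 where vw: "v \<in> carrier M" "w \<in> carrier M"
      and m: "\<forall>m\<ge>m1. l m v = \<zero>\<^bsub>R\<^esub>" "\<forall>m\<ge>m2. l m w = \<zero>\<^bsub>R\<^esub>" by blast
    then have "\<forall>m\<ge>max m1 m2. l m (v \<oplus>\<^bsub>M\<^esub> w) = \<zero>\<^bsub>R\<^esub>" by (simp add: l_add)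
    then show "v \<oplus>\<^bsub>M\<^esub> w \<in> ?V" using vw by blast
  qed blast
  moreover have "T0 \<subseteq> ?V"
  proof
    fix v assume v: "v \<in> T0"
    have "\<exists>m0. \<forall>m\<ge>m0. l m v = \<zero>\<^bsub>R\<^esub>"
    proof (cases "v \<in> S'")
      case True
      then show ?thesis using lS' by blast
    next
      case False
      then obtain n where "v = y n" using v by (auto simp: T0_def)
      then show ?thesis by (intro exI[of _ "Suc n"]) (auto simp: ly)
    qed
    then show "v \<in> ?V" using v T0M by blast
  qed
  ultimately have "u \<in> ?V" using span_minimal u by blast
  then obtain m0 where m0: "\<And>m. m \<ge> m0 \<Longrightarrow> l m u = \<zero>\<^bsub>R\<^esub>" and uM: "u \<in> carrier M" by blast
  define m where "m = max m0 (Suc N)"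
  have m: "Suc N \<le> m" "l m u = \<zero>\<^bsub>R\<^esub>" using m0 by (auto simp: m_def)
  let ?Q = "?P (Suc N) (m - Suc N)"
  have "l m (e (Suc N)) = l m (e (Suc N)) \<otimes>\<^bsub>R\<^esub> a N \<otimes>\<^bsub>R\<^esub> r"
  proof -
    have "l m (e (Suc N)) = l m u \<oplus>\<^bsub>R\<^esub> l m (x N) \<otimes>\<^bsub>R\<^esub> r"
      using uM xM r by (subst eu) (simp add: l_add l_smult smult_closed)
    then show ?thesis
      using m(2) a eM r l_closed by (simp add: x_def l_smult)
  qed
  then have "?Q = ?Q \<otimes>\<^bsub>R\<^esub> a N \<otimes>\<^bsub>R\<^esub> r" using m(1) by (simp add: le)
  then have "?Q \<otimes>\<^bsub>R\<^esub> (\<one>\<^bsub>R\<^esub> \<ominus>\<^bsub>R\<^esub> a N \<otimes>\<^bsub>R\<^esub> r) = \<zero>\<^bsub>R\<^esub>"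
    using P a r
    by (metis R.m_assoc R.m_closed R.minus_eq R.one_closed R.r_distr R.r_minus R.r_neg R.r_one R.add.inv_closed)
  then show "\<exists>N k. \<exists>r\<in>carrier R. ?P (Suc N) k \<otimes>\<^bsub>R\<^esub> (\<one>\<^bsub>R\<^esub> \<ominus>\<^bsub>R\<^esub> a N \<otimes>\<^bsub>R\<^esub> r) = \<zero>\<^bsub>R\<^esub>"
    using r by blast
qed


section \<open>Projective covers\<close>

context right_module
begin

text \<open>
  Let \<open>T\<close> be the set of all \<open>x\<close> with \<open>x = x f\<close> for some local idempotent \<open>f\<close>.  Zorn's lemma provides a
  set \<open>B\<close> that is maximal among the subsets of \<open>T\<close> that are weakly independent modulo the radical
  multiples.  Maximality yields generation by an exchange argument: if \<open>y = y f\<close> could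
  not be added to \<open>B\<close>, some \<open>x \<in> B\<close> is \<open>u + y q\<close> with \<open>q \<in> f R\<close>.  Either \<open>q\<close> is in the radical, which
  contradicts the independence of \<open>B\<close>, or \<open>q s = f\<close> for some \<open>s\<close>, and \<open>y = (x - u) s\<close> was generated
  already.  As \<open>1\<close> is a sum of local idempotents, \<open>T\<close> generates the module.
\<close>

lemma maximal_independent_generators_mod_radical:
  assumes one: "sum_of_local_idempotents R \<one>\<^bsub>R\<^esub>"
  shows "\<exists>B\<subseteq>carrier M. (\<forall>x\<in>B. \<exists>f. local_idempotent R f \<and> f \<odot>\<^bsub>M\<^esub> x = x) \<and>
    (\<forall>x\<in>B. x \<notin> mod_span R M ((B - {x}) \<union> radical_multiples R M)) \<and>
    carrier M \<subseteq> mod_span R M (B \<union> radical_multiples R M)"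
proof -
  let ?Q = "radical_multiples R M"
  note Q = radical_multiples_subset
  define T where "T = {x \<in> carrier M. \<exists>f. local_idempotent R f \<and> f \<odot>\<^bsub>M\<^esub> x = x}"
  define \<B> where "\<B> = {B. B \<subseteq> T \<and> (\<forall>x\<in>B. x \<notin> mod_span R M ((B - {x}) \<union> ?Q))}"
  have TM: "T \<subseteq> carrier M" by (auto simp: T_def)
  have "\<exists>B\<in>\<B>. \<forall>X\<in>\<B>. B \<subseteq> X \<longrightarrow> X = B"
  proof (rule subset_Zorn')
    fix C assume C: "subset.chain \<B> C"
    then have C\<B>: "C \<subseteq> \<B>" by (simp add: subset.chain_def)
    have "x \<notin> mod_span R M ((\<Union>C - {x}) \<union> ?Q)" if x: "x \<in> \<Union>C" for x
    proof
      assume "x \<in> mod_span R M ((\<Union>C - {x}) \<union> ?Q)"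
      moreover have "(\<Union>C - {x}) \<union> ?Q \<subseteq> carrier M" using C\<B> TM Q by (auto simp: \<B>_def)
      ultimately have "\<exists>A\<subseteq>(\<Union>C - {x}) \<union> ?Q. finite A \<and> x \<in> mod_span R M A"
        by (intro span_finite_character)
      then obtain A where A: "A \<subseteq> (\<Union>C - {x}) \<union> ?Q" "finite A" "x \<in> mod_span R M A"
        by (elim exE conjE)
      have "finite (insert x (A - ?Q))" "insert x (A - ?Q) \<subseteq> \<Union>C" "C \<noteq> {}"
        using A x by auto
      then obtain B where B: "B \<in> C" "insert x (A - ?Q) \<subseteq> B"
        by (rule finite_subset_Union_chain[OF _ _ _ C])
      then have "A \<subseteq> (B - {x}) \<union> ?Q" using A(1) by blast
      then have "x \<in> mod_span R M ((B - {x}) \<union> ?Q)" using A(3) by (rule subsetD[OF span_mono])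
      moreover have "B \<in> \<B>" "x \<in> B" using B C\<B> by blast+
      moreover have "\<forall>x\<in>B. x \<notin> mod_span R M ((B - {x}) \<union> ?Q)"
        using \<open>B \<in> \<B>\<close> by (simp add: \<B>_def)
      ultimately show False by simp
    qed
    then show "\<Union>C \<in> \<B>" using C\<B> by (auto simp: \<B>_def)
  qed
  then obtain B where B: "B \<in> \<B>" and max: "\<And>X. X \<in> \<B> \<Longrightarrow> B \<subseteq> X \<Longrightarrow> X = B" by blast
  have BT: "B \<subseteq> T" and indep: "\<And>x. x \<in> B \<Longrightarrow> x \<notin> mod_span R M ((B - {x}) \<union> ?Q)"
    using B by (auto simp: \<B>_def)
  let ?U = "mod_span R M (B \<union> ?Q)"
  have BQ: "B \<union> ?Q \<subseteq> carrier M" using BT TM Q by blast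
  note U = span_submodule[OF BQ]
  have TU: "y \<in> ?U" if y: "y \<in> T" for y
  proof (rule ccontr)
    assume yU: "y \<notin> ?U"
    obtain f where f: "local_idempotent R f" "f \<odot>\<^bsub>M\<^esub> y = y" and yM: "y \<in> carrier M"
      using y by (auto simp: T_def)
    have fR: "f \<in> carrier R" "f \<otimes>\<^bsub>R\<^esub> f = f" using f by (auto simp: local_idempotent_def)
    have yB: "y \<notin> B" using yU span_inc by blast
    have "x \<notin> mod_span R M ((insert y B - {x}) \<union> ?Q)" if x: "x \<in> insert y B" for x
    proof
      assume xs: "x \<in> mod_span R M ((insert y B - {x}) \<union> ?Q)"
      show False
      proof (cases "x = y")
        case True
        then have "(insert y B - {x}) \<union> ?Q \<subseteq> B \<union> ?Q" by blast
        then show False using span_mono xs yU True by blast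
      next
        case False
        then have xB: "x \<in> B" using x by blast
        let ?V = "(B - {x}) \<union> ?Q"
        have VM: "?V \<subseteq> carrier M" using BQ by blast
        note V = span_submodule[OF VM]
        have "(insert y B - {x}) \<union> ?Q = insert y ?V" using False by blast
        then obtain u r where u: "u \<in> mod_span R M ?V" and r: "r \<in> carrier R"
          and xu: "x = u \<oplus>\<^bsub>M\<^esub> r \<odot>\<^bsub>M\<^esub> y"
          using span_insert[OF VM yM] xs by metis
        define q where "q = f \<otimes>\<^bsub>R\<^esub> r"
        have q: "q \<in> carrier R" "f \<otimes>\<^bsub>R\<^esub> q = q"
          using r fR by (simp_all add: q_def flip: R.m_assoc)
        have ry: "r \<odot>\<^bsub>M\<^esub> y = q \<odot>\<^bsub>M\<^esub> y"
          using smult_assoc[OF fR(1) r yM] f by (simp add: q_def)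
        have uM: "u \<in> carrier M" using u span_closed[OF VM] by blast
        show False
        proof (cases "q \<in> jacobson_radical R")
          case True
          then have "q \<odot>\<^bsub>M\<^esub> y \<in> ?V" using yM by (auto simp: radical_multiples_def)
          then have "q \<odot>\<^bsub>M\<^esub> y \<in> mod_span R M ?V" by (rule span_inc)
          then have "u \<oplus>\<^bsub>M\<^esub> q \<odot>\<^bsub>M\<^esub> y \<in> mod_span R M ?V" by (rule submodule_add[OF V u])
          then have "x \<in> mod_span R M ?V" by (simp only: xu[symmetric] ry[symmetric])
          then show False using indep[OF xB] by blast
        next
          case False
          then have "q \<in> carrier R - jacobson_radical R" using q by blast
          then obtain s where s: "s \<in> carrier R" "q \<otimes>\<^bsub>R\<^esub> s = f"
            using f(1) q(2) unfolding local_idempotent_def by blast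
          have "?V \<subseteq> B \<union> ?Q" by blast
          then have uU: "u \<in> ?U" using u by (rule subsetD[OF span_mono])
          have "x \<in> ?U" using xB by (intro span_inc) simp
          then have "x \<oplus>\<^bsub>M\<^esub> \<ominus>\<^bsub>M\<^esub> u \<in> ?U"
            using submodule_minus[OF U uU] by (rule submodule_add[OF U])
          also have "x \<oplus>\<^bsub>M\<^esub> \<ominus>\<^bsub>M\<^esub> u = q \<odot>\<^bsub>M\<^esub> y"
            unfolding xu ry using uM smult_closed[OF q(1) yM]
            by (simp add: M.a_ac M.r_neg M.r_neg2)
          finally have "s \<odot>\<^bsub>M\<^esub> (q \<odot>\<^bsub>M\<^esub> y) \<in> ?U" by (rule submodule_smult[OF U s(1)])
          then show False
            using smult_assoc[OF q(1) s(1) yM] s(2) f(2) yU by simp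
        qed
      qed
    qed
    then have "insert y B \<in> \<B>" using y BT by (simp add: \<B>_def)
    then have "insert y B = B" by (rule max) blast
    then show False using yB by blast
  qed
  have mem: "e \<in> carrier R \<and> e \<odot>\<^bsub>M\<^esub> y \<in> ?U" if y: "y \<in> carrier M" and "sum_of_local_idempotents R e"
    for e y
    using that(2)
  proof induction
    case zero
    then show ?case using y submodule_zero[OF U] by (simp add: smult_zero_left)
  next
    case (single f)
    then have f: "f \<in> carrier R" "f \<otimes>\<^bsub>R\<^esub> f = f" by (auto simp: local_idempotent_def)
    have "f \<odot>\<^bsub>M\<^esub> (f \<odot>\<^bsub>M\<^esub> y) = f \<odot>\<^bsub>M\<^esub> y"
      using smult_assoc[OF f(1) f(1) y] f(2) by simp
    then have "f \<odot>\<^bsub>M\<^esub> y \<in> T" using single f y smult_closed by (auto simp: T_def)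
    then show ?case using TU f by blast
  next
    case (add g h)
    then show ?case using y submodule_add[OF U] by (simp add: smult_scalar_distr)
  qed
  have "carrier M \<subseteq> ?U"
  proof
    fix y assume "y \<in> carrier M"
    then show "y \<in> ?U" using mem[OF _ one, of y] smult_one[of y] by simp
  qed
  then show ?thesis using BT indep TM by (intro exI[of _ B]) (auto simp: T_def)
qed

end

text \<open>
  Let \<open>B\<close> be as in the preceding lemma and choose local idempotents \<open>f x\<close> with \<open>x f x = x\<close> for \<open>x \<in> B\<close>.  The cover
  is the direct sum of the \<open>f x R\<close>, mapping the generator of the summand at \<open>x\<close> to \<open>x\<close>.  It is onto by
  Nakayama's lemma.  If \<open>\<phi>\<close> is in the kernel and a component \<open>\<phi> x\<close> were outside the radical, then
  \<open>\<phi> x s = f x\<close> for some \<open>s\<close>, so \<open>x\<close> would be in the span of the other elements of \<open>B\<close>.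
  So the kernel consists of sums of radical multiples, and it is superfluous by Nakayama's lemma again.
\<close>

lemma (in ring) no_strict_bass_chain_imp_right_perfect:
  assumes bass: "no_strict_bass_chain R"
  shows "right_perfect TYPE('m) R"
  unfolding right_perfect_def
proof (intro conjI allI impI)
  show "ring R" by (rule ring_axioms)
  fix M :: "('a, 'm) module" assume M: "right_module R M"
  then interpret right_module R M .
  let ?Q = "radical_multiples R M"
  note T = jacobson_radical_T_nilpotent[OF bass]
  obtain B where BM: "B \<subseteq> carrier M"
    and loc: "\<And>x. x \<in> B \<Longrightarrow> \<exists>f. local_idempotent R f \<and> f \<odot>\<^bsub>M\<^esub> x = x"
    and indep: "\<And>x. x \<in> B \<Longrightarrow> x \<notin> mod_span R M ((B - {x}) \<union> ?Q)"
    and gen: "carrier M \<subseteq> mod_span R M (B \<union> ?Q)"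
    using maximal_independent_generators_mod_radical[OF one_sum_of_local_idempotents[OF bass]] by metis
  obtain f0 where f0: "\<And>x. x \<in> B \<Longrightarrow> local_idempotent R (f0 x) \<and> f0 x \<odot>\<^bsub>M\<^esub> x = x"
    using loc by metis
  define f where "f x = (if x \<in> B then f0 x else \<zero>)" for x
  define g where "g x = (if x \<in> B then x else \<zero>\<^bsub>M\<^esub>)" for x
  have f: "f x \<in> carrier R" "f x \<otimes> f x = f x" for x
    using f0[of x] by (auto simp: f_def local_idempotent_def)
  have g: "g x \<in> carrier M" for x using BM by (auto simp: g_def)
  let ?P = "ideal_sum R f"
  have P: "right_module R ?P" using f(1) by (rule ideal_sum_module)
  interpret P: right_module R ?P by (rule P)
  let ?p = "combination R M g"
  have p: "?p \<in> right_module_hom R ?P M" using f(1) g by (rule combination_hom)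
  have gen_P: "single R x (f x) \<in> carrier ?P" for x using f by (intro single_in_ideal_sum) auto
  have single_eq: "single R x (\<phi> x) = \<phi> x \<odot>\<^bsub>?P\<^esub> single R x (f x)" if "\<phi> \<in> carrier ?P" for x \<phi>
    using that by (auto simp: ideal_sum_carrier single_def ideal_sum_simps)
  have p_single: "?p (single R x r) = r \<odot>\<^bsub>M\<^esub> g x" if "r \<in> carrier R" for x r
    using that g by (rule combination_single)
  have img: "submodule (?p ` carrier ?P) R M" by (rule submodule_hom_image[OF P M p])
  have "B \<subseteq> ?p ` carrier ?P"
  proof
    fix x assume x: "x \<in> B"
    then have "f x \<odot>\<^bsub>M\<^esub> g x = x" using f0[OF x] by (simp add: f_def g_def)
    then have "?p (single R x (f x)) = x" using p_single[of "f x" x, OF f(1)] by simp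
    then show "x \<in> ?p ` carrier ?P" using gen_P by (metis imageI)
  qed
  then have "B \<union> ?Q \<subseteq> ?p ` carrier ?P \<union> ?Q" by blast
  then have "carrier M \<subseteq> mod_span R M (?p ` carrier ?P \<union> ?Q)"
    using gen span_mono by (meson order_trans)
  then have surj: "?p ` carrier ?P = carrier M" by (rule radical_Nakayama[OF T img])
  have ker: "\<phi> x \<in> jacobson_radical R" if \<phi>: "\<phi> \<in> carrier ?P" "?p \<phi> = \<zero>\<^bsub>M\<^esub>" for \<phi> x
  proof (rule ccontr)
    assume nJ: "\<phi> x \<notin> jacobson_radical R"
    have \<phi>x: "\<phi> y \<in> carrier R" "f y \<otimes> \<phi> y = \<phi> y" for y using \<phi> by (auto simp: ideal_sum_carrier)
    have x: "x \<in> B"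
    proof (rule ccontr)
      assume "x \<notin> B"
      then have "\<phi> x = \<zero>" using \<phi>x[of x] by (simp add: f_def)
      then show False using nJ zero_in_jacobson_radical by simp
    qed
    let ?S = "mod_span R M (B - {x})"
    have SM: "B - {x} \<subseteq> carrier M" using BM by blast
    note S = span_submodule[OF SM]
    \<comment> \<open>the part of \<open>\<phi>\<close> off \<open>x\<close>, which maps into the span of \<open>B - {x}\<close>\<close>
    define \<psi> where "\<psi> = \<phi>(x := \<zero>)"
    have \<psi>P: "\<psi> \<in> carrier ?P"
    proof -
      have "{y. \<psi> y \<noteq> \<zero>} \<subseteq> {y. \<phi> y \<noteq> \<zero>}" by (auto simp: \<psi>_def)
      then show ?thesis
        using \<phi> f by (auto simp: \<psi>_def ideal_sum_carrier intro: finite_subset)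
    qed
    have "\<psi> \<in> {\<psi> \<in> carrier ?P. ?p \<psi> \<in> ?S}"
    proof (rule ideal_sum_induct[OF _ submodule_hom_preimage[OF P M p S] \<psi>P])
      show "f y \<in> carrier R" for y by (rule f)
      fix y
      have \<psi>y: "\<psi> y \<in> carrier R" "f y \<otimes> \<psi> y = \<psi> y" using \<psi>P by (auto simp: ideal_sum_carrier)
      have "\<psi> y \<odot>\<^bsub>M\<^esub> g y \<in> ?S"
      proof (cases "y \<in> B - {x}")
        case True
        then have "g y \<in> ?S" using span_inc[OF True] by (simp add: g_def)
        then show ?thesis by (rule submodule_smult[OF S \<psi>y(1)])
      next
        case False
        then have "\<psi> y \<odot>\<^bsub>M\<^esub> g y = \<zero>\<^bsub>M\<^esub>"
          using g \<psi>y by (cases "y = x") (auto simp: \<psi>_def g_def smult_zero_left smult_zero_right)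
        then show ?thesis using submodule_zero[OF S] by simp
      qed
      moreover have "single R y (\<psi> y) \<in> carrier ?P"
        using f(1) \<psi>y by (rule single_in_ideal_sum)
      ultimately show "single R y (\<psi> y) \<in> {\<psi> \<in> carrier ?P. ?p \<psi> \<in> ?S}"
        using p_single[OF \<psi>y(1)] by simp
    qed
    then have p\<psi>: "?p \<psi> \<in> ?S" by simp
    have sP: "single R x (\<phi> x) \<in> carrier ?P" using f(1) \<phi>x by (rule single_in_ideal_sum)
    have "\<phi> = single R x (\<phi> x) \<oplus>\<^bsub>?P\<^esub> \<psi>"
      using \<phi>x by (auto simp: \<psi>_def single_def ideal_sum_simps)
    then have "?p (single R x (\<phi> x) \<oplus>\<^bsub>?P\<^esub> \<psi>) = \<zero>\<^bsub>M\<^esub>" using \<phi>(2) by simp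
    then have "\<phi> x \<odot>\<^bsub>M\<^esub> x \<oplus>\<^bsub>M\<^esub> ?p \<psi> = \<zero>\<^bsub>M\<^esub>"
      using right_module_hom_add[OF p sP \<psi>P] p_single[OF \<phi>x(1)] x by (simp add: g_def)
    then have "\<phi> x \<odot>\<^bsub>M\<^esub> x = \<ominus>\<^bsub>M\<^esub> ?p \<psi>"
      using x BM \<phi>x(1)[of x] smult_closed right_module_hom_closed[OF p \<psi>P]
      by (intro M.minus_equality[symmetric]) auto
    then have xS: "\<phi> x \<odot>\<^bsub>M\<^esub> x \<in> ?S" using submodule_minus[OF S p\<psi>] by simp
    obtain s where s: "s \<in> carrier R" "\<phi> x \<otimes> s = f x"
      using f0[OF x] nJ \<phi>x[of x] x unfolding local_idempotent_def f_def by auto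
    have "x = s \<odot>\<^bsub>M\<^esub> (\<phi> x \<odot>\<^bsub>M\<^esub> x)"
      using smult_assoc[OF \<phi>x(1) s(1), of x x] s(2) f0[OF x] x BM by (auto simp: f_def)
    then have "x \<in> ?S" using submodule_smult[OF S s(1) xS] by simp
    then show False using indep[OF x] span_mono[of "B - {x}" "(B - {x}) \<union> ?Q"] by blast
  qed
  let ?K = "a_kernel ?P M ?p"
  have K_def: "?K = {\<phi> \<in> carrier ?P. ?p \<phi> \<in> {\<zero>\<^bsub>M\<^esub>}}" by (auto simp: a_kernel_def')
  have "superfluous R ?P ?K"
    unfolding superfluous_def
  proof (intro conjI allI impI)
    have "submodule {\<zero>\<^bsub>M\<^esub>} R M" by (rule right_submoduleI) (auto simp: smult_zero_right)
    then show "submodule ?K R ?P" unfolding K_def by (rule submodule_hom_preimage[OF P M p])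
    fix N assume "submodule N R ?P \<and> ?K <+>\<^bsub>?P\<^esub> N = carrier ?P"
    then have N: "submodule N R ?P" and KN: "?K <+>\<^bsub>?P\<^esub> N = carrier ?P" by auto
    let ?NQ = "N \<union> radical_multiples R ?P"
    have NQ: "?NQ \<subseteq> carrier ?P"
      using P.submodule_subset[OF N] P.radical_multiples_subset by blast
    note W = P.span_submodule[OF NQ]
    have K_sub: "\<phi> \<in> mod_span R ?P ?NQ" if \<phi>: "\<phi> \<in> ?K" for \<phi>
    proof -
      have \<phi>P: "\<phi> \<in> carrier ?P" "?p \<phi> = \<zero>\<^bsub>M\<^esub>" using \<phi> by (auto simp: K_def)
      show ?thesis
      proof (rule ideal_sum_induct[OF _ W \<phi>P(1)])
        show "f y \<in> carrier R" for y by (rule f)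
        fix x
        have "\<phi> x \<odot>\<^bsub>?P\<^esub> single R x (f x) \<in> ?NQ"
          using ker[OF \<phi>P] gen_P unfolding radical_multiples_def by blast
        then show "single R x (\<phi> x) \<in> mod_span R ?P ?NQ"
          unfolding single_eq[OF \<phi>P(1)] by (rule P.span_inc)
      qed
    qed
    have "carrier ?P \<subseteq> mod_span R ?P ?NQ"
    proof
      fix \<phi> assume "\<phi> \<in> carrier ?P"
      then have "\<phi> \<in> ?K <+>\<^bsub>?P\<^esub> N" using KN by simp
      then obtain \<kappa> \<nu> where "\<kappa> \<in> ?K" "\<nu> \<in> N" "\<phi> = \<kappa> \<oplus>\<^bsub>?P\<^esub> \<nu>"
        unfolding set_add_def' by blast
      then show "\<phi> \<in> mod_span R ?P ?NQ"
        using P.submodule_add[OF W K_sub P.span_inc[of \<nu>]] by simp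
    qed
    then show "N = carrier ?P" by (rule P.radical_Nakayama[OF T N])
  qed
  moreover have "projective_module R ?P" using f by (rule ideal_sum_projective)
  moreover have "?p \<in> right_module_epi R ?P M" using p surj by (simp add: right_module_epi_def)
  ultimately show "\<exists>(P :: ('a, 'm \<Rightarrow> 'a) module) p. projective_cover R P M p"
    unfolding projective_cover_def by blast
qed


section \<open>Free modules over rings that are not right perfect\<close>

theorem lemma2p2:
  fixes R :: "('a, 'r) ring_scheme"
    and F :: "('a, 'f) module"
  assumes "ring R"
    and "\<not> right_perfect TYPE('m) R"
    and "right_module R F"
    and "free_module R F"
  shows "regularly_weakly_based R F \<longleftrightarrow> finitely_generated R F"
proof
  interpret right_module R F by fact
  show "regularly_weakly_based R F" if "finitely_generated R F"
    using that by (rule finitely_generated_imp_regularly_weakly_based)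
  assume rwb: "regularly_weakly_based R F"
  obtain S where S: "linearly_independent R F S" "generating_set R F S"
    using assms(4) unfolding free_module_def by (elim exE conjE)
  have "finite S"
  proof (rule ccontr)
    assume "infinite S"
    then have "no_strict_bass_chain R"
      using regularly_weakly_based_imp_no_strict_bass_chain[OF S _ rwb] by simp
    then have "right_perfect TYPE('m) R"
      by (rule ring.no_strict_bass_chain_imp_right_perfect[OF assms(1)])
    then show False using assms(2) by simp
  qed
  then show "finitely_generated R F"
    using S(2) unfolding finitely_generated_def by (intro exI conjI)
qed

end
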